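(* Suppose that $r$ is an even integer and $k$ is an odd integer. Let $G$ be a connected $r$-regular graph of order $n$. Let $m \geq 3$ be an integer and let $m_0 \in \{m, m-1\}$ be odd. Suppose that $\frac{r}{m} \leq k \leq r\left(1 - \frac{1}{m}\right)$. (i) If $n$ is odd and $\lambda_2(G) < \rho_1(r, m_0 - 1)$, then $G$ is $k$-critical. (ii) If $n$ is even and $\lambda_3(G) < \rho_1(r, m_0 - 1)$, then $G$ contains a $k$-factor.
   Context: All graphs are finite and simple. $\lambda_1(X) \geq \lambda_2(X) \geq \lambda_3(X) \geq \cdots$ denote the eigenvalues of the adjacency matrix of a graph $X$. For integers $r$ and $t$, $\rho_1(r,t)$ denotes the minimum of $\lambda_1(H)$ over all connected irregular (not regular) graphs $H$ of order $n'$ with $n' \not\equiv r \pmod 2$, maximum degree $r$, and size $e'$ satisfying $2e' \geq rn' - t$. A $k$-factor of $G$ is a spanning subgraph $F$ with $d_F(x) = k$ for all vertices $x$. $G$ is called $k$-critical if $G$ contains no $k$-factor, but for every vertex $x$ of $G$ there exists a spanning subgraph $H$ of $G$ with $d_H(x) = k-1$ or $d_H(x) = k+1$, and $d_H(y) = k$ for every vertex $y \neq x$. *)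

theory Defs
  imports
    "Graph_Theory.Digraph_Component"
    "Jordan_Normal_Form.Char_Poly"
    "HOL-Number_Theory.Cong"
begin

text \<open>
  A finite simple graph is a \<^locale>\<open>pair_graph\<close>: a finite, loop-free digraph without
  parallel arcs whose arc relation is symmetric. An undirected edge \<open>{u, v}\<close> is the pair
  of arcs \<open>(u, v)\<close> and \<open>(v, u)\<close>, so the degree of a vertex is its out-degree.
\<close>

abbreviation vdegree :: "'a pair_pre_digraph \<Rightarrow> 'a \<Rightarrow> nat" where
  "vdegree G v \<equiv> out_degree (with_proj G) v"

abbreviation gorder :: "'a pair_pre_digraph \<Rightarrow> nat" where
  "gorder G \<equiv> card (pverts G)"

definition gsize :: "'a pair_pre_digraph \<Rightarrow> nat" where
  "gsize G = card ((\<lambda>(u, v). {u, v}) ` parcs G)"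

text \<open>The library's connectedness excludes the graph without vertices.\<close>

abbreviation gconnected :: "'a pair_pre_digraph \<Rightarrow> bool" where
  "gconnected G \<equiv> Digraph_Component.connected (with_proj G)"

definition regular :: "int \<Rightarrow> 'a pair_pre_digraph \<Rightarrow> bool" where
  "regular d G \<longleftrightarrow> (\<forall>v \<in> pverts G. int (vdegree G v) = d)"

definition irregular :: "'a pair_pre_digraph \<Rightarrow> bool" where
  "irregular G \<longleftrightarrow> \<not> (\<exists>d. regular d G)"

definition max_degree :: "'a pair_pre_digraph \<Rightarrow> nat" where
  "max_degree G = Max (vdegree G ` pverts G)"

definition adj_mat :: "'a pair_pre_digraph \<Rightarrow> 'a list \<Rightarrow> real mat" where
  "adj_mat G vs =
     mat (length vs) (length vs) (\<lambda>(i, j). if (vs ! i, vs ! j) \<in> parcs G then 1 else 0)"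

text \<open>
  The eigenvalues with multiplicity, in weakly decreasing order. The chosen enumeration of the
  vertices is immaterial, since different enumerations give similar matrices. All complex
  eigenvalues of a real symmetric matrix are real, so no root of the characteristic polynomial
  is lost over the reals.
\<close>

definition adj_eigenvalues :: "'a pair_pre_digraph \<Rightarrow> real list" where
  "adj_eigenvalues G =
     rev (sorted_list_of_multiset (proots (char_poly
       (adj_mat G (SOME vs. distinct vs \<and> set vs = pverts G)))))"

text \<open>Indices start at 1; the value is meaningful for \<open>1 \<le> i \<le> gorder G\<close>.\<close>

definition lam :: "nat \<Rightarrow> 'a pair_pre_digraph \<Rightarrow> real" where
  "lam i G = adj_eigenvalues G ! (i - 1)"

text \<open>
  Every finite graph is isomorphic to one with vertices in \<^typ>\<open>nat\<close>, so restricting the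
  vertex type loses no value of the largest eigenvalue.
\<close>

definition rho1_graphs :: "int \<Rightarrow> int \<Rightarrow> nat pair_pre_digraph set" where
  "rho1_graphs r t =
     {H. pair_graph H \<and> gconnected H \<and> irregular H
         \<and> \<not> [int (gorder H) = r] (mod 2)
         \<and> int (max_degree H) = r
         \<and> 2 * int (gsize H) \<ge> r * int (gorder H) - t}"

text \<open>
  The minimum, as the least element of the set of values. For even \<open>r \<ge> 2\<close> and \<open>t \<ge> 2\<close> the
  complete graph on \<open>r + 1\<close> vertices minus an edge is admissible. The minimum is then attained:
  \<open>lam 1 H\<close> is at least the average degree \<open>r - t / gorder H\<close>, which tends to \<open>r\<close>, and is less
  than \<open>r\<close> for each admissible \<open>H\<close>, so only finitely many orders matter.
\<close>

definition rho1 :: "int \<Rightarrow> int \<Rightarrow> real" where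
  "rho1 r t = (LEAST x. x \<in> lam 1 ` rho1_graphs r t)"

definition spanning_subgraph :: "'a pair_pre_digraph \<Rightarrow> 'a pair_pre_digraph \<Rightarrow> bool" where
  "spanning_subgraph F G \<longleftrightarrow> pair_graph F \<and> spanning (with_proj F) (with_proj G)"

definition is_factor :: "int \<Rightarrow> 'a pair_pre_digraph \<Rightarrow> 'a pair_pre_digraph \<Rightarrow> bool" where
  "is_factor k F G \<longleftrightarrow>
     spanning_subgraph F G \<and> (\<forall>x \<in> pverts G. int (vdegree F x) = k)"

definition has_factor :: "int \<Rightarrow> 'a pair_pre_digraph \<Rightarrow> bool" where
  "has_factor k G \<longleftrightarrow> (\<exists>F. is_factor k F G)"

definition critical :: "int \<Rightarrow> 'a pair_pre_digraph \<Rightarrow> bool" where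
  "critical k G \<longleftrightarrow>
     \<not> has_factor k G \<and>
     (\<forall>x \<in> pverts G. \<exists>H. spanning_subgraph H G
        \<and> (int (vdegree H x) = k - 1 \<or> int (vdegree H x) = k + 1)
        \<and> (\<forall>y \<in> pverts G. y \<noteq> x \<longrightarrow> int (vdegree H y) = k))"

end

theory Submission
  imports "Jordan_Normal_Form.Spectral_Radius" "HOL-Combinatorics.List_Permutation" Defs
begin

text \<open>
  Suppose the required factor does not exist; in the odd case the degree at one vertex \<open>x\<close> may be
  \<open>k - 1\<close> or \<open>k + 1\<close>. Tutte's perfect matching theorem, applied to a gadget graph, yields disjoint
  vertex sets \<open>S\<close> and \<open>T\<close> of deficiency at least two. Let an edge between a component of
  \<open>G - S - T\<close> and \<open>S\<close> weigh \<open>k\<close>, and one between it and \<open>T\<close> weigh \<open>r - k\<close>. Counting the edges at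
  \<open>S \<union> T\<close> shows that the weights of the \<open>q\<close> odd components sum to at most \<open>(q - 2) r\<close>; as \<open>G\<close> is
  connected every weight is positive, so at least three components weigh less than \<open>r\<close>. Such a
  component not containing \<open>x\<close> has odd order and is joined to \<open>S \<union> T\<close> by at most \<open>m0 - 1\<close> edges,
  which makes it a competitor in the definition of \<open>rho1 r (m0 - 1)\<close>. There are no edges between
  different components, so by the Courant--Fischer principle the second (third) eigenvalue of \<open>G\<close>
  is at least the smallest of their largest eigenvalues.
\<close>

section \<open>Components and perfect matchings\<close>

text \<open>The weights are dictated by a cancellation. Add \<open>k\<close> times the edge count at
  \<open>S\<close> and \<open>r - k\<close> times the one at \<open>T\<close>: the edges between
  \<open>S\<close> and \<open>T\<close> then occur \<open>r\<close> times, as in \<open>r\<close>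
  times the barrier inequality, and disappear. The same weights force odd order. Let a component
  without exceptional vertex have \<open>s\<close> edges to \<open>S\<close> and \<open>t\<close> to
  \<open>T\<close>. Since \<open>r\<close> is even, \<open>s + t\<close> is even. If the order were
  even, the parity condition of the barrier would make \<open>s\<close> odd, hence \<open>t\<close>
  odd, and the weight would be at least k + (r - k) = r. The hypothesis on \<open>k\<close> says
  that every edge weighs at least r/m; a weight below \<open>r\<close> thus leaves s + t < m, and
  \<open>m0 - 1\<close> is the largest even integer below \<open>m\<close>. The obstacle is that a
  Tutte barrier of the gadget may contain some copies of a vertex and miss others. A barrier of
  least size cannot, so \<open>S\<close> and \<open>T\<close> can be read off from it. For odd
  \<open>n\<close>, the target \<open>k + 1\<close> at \<open>x\<close> makes the degree sum kn + 1
  even, but it spoils the parity condition for the component containing \<open>x\<close>; this is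
  why (i) speaks of the second eigenvalue and (ii) of the third.\<close>

definition gcomp :: "('b \<times> 'b) set \<Rightarrow> 'b set \<Rightarrow> 'b \<Rightarrow> 'b set" where
  "gcomp E A x = {y. (x, y) \<in> (E \<inter> A \<times> A)\<^sup>*}"

text \<open>The arc relation stays fixed while the vertex set varies, so deleting vertices never
  requires forming a subgraph, and the same facts serve for the given graph and for its
  gadget.\<close>

definition comps :: "('b \<times> 'b) set \<Rightarrow> 'b set \<Rightarrow> 'b set set" where
  "comps E A = gcomp E A ` A"

definition odd_comps :: "('b \<times> 'b) set \<Rightarrow> 'b set \<Rightarrow> 'b set set" where
  "odd_comps E A = {C \<in> comps E A. odd (card C)}"

abbreviation oddc :: "('b \<times> 'b) set \<Rightarrow> 'b set \<Rightarrow> nat" where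
  "oddc E A \<equiv> card (odd_comps E A)"

lemma gcomp_self: "x \<in> gcomp E A x"
  by (simp add: gcomp_def)

lemma gcomp_least:
  assumes "x \<in> X" and "\<And>a b. a \<in> X \<Longrightarrow> a \<in> A \<Longrightarrow> b \<in> A \<Longrightarrow> (a, b) \<in> E \<Longrightarrow> b \<in> X"
  shows "gcomp E A x \<subseteq> X"
proof
  fix y assume "y \<in> gcomp E A x"
  then have "(x, y) \<in> (E \<inter> A \<times> A)\<^sup>*" by (simp add: gcomp_def)
  then show "y \<in> X" by (induction rule: rtrancl_induct) (use assms in auto)
qed

lemma gcomp_subset: "x \<in> A \<Longrightarrow> gcomp E A x \<subseteq> A"
  by (rule gcomp_least) auto

lemma gcomp_step: "y \<in> gcomp E A x \<Longrightarrow> y \<in> A \<Longrightarrow> z \<in> A \<Longrightarrow> (y, z) \<in> E \<Longrightarrow> z \<in> gcomp E A x"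
  by (auto simp: gcomp_def intro: rtrancl_into_rtrancl)

lemma gcomp_eq:
  assumes "sym E" "y \<in> gcomp E A x" shows "gcomp E A y = gcomp E A x"
proof -
  have "sym (E \<inter> A \<times> A)" using assms(1) by (auto simp: sym_def)
  then have "sym ((E \<inter> A \<times> A)\<^sup>*)" by (rule sym_rtrancl)
  then show ?thesis using assms(2) unfolding gcomp_def
    by (auto dest: symD intro: rtrancl_trans)
qed

lemma comps_nonempty: "C \<in> comps E A \<Longrightarrow> C \<noteq> {}"
  using gcomp_self by (fastforce simp: comps_def)

lemma comps_subset: "C \<in> comps E A \<Longrightarrow> C \<subseteq> A"
  using gcomp_subset by (fastforce simp: comps_def)

lemma finite_comps: "finite A \<Longrightarrow> finite (comps E A)"
  by (simp add: comps_def)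

lemma finite_odd_comps: "finite A \<Longrightarrow> finite (odd_comps E A)"
  by (simp add: odd_comps_def finite_comps)

lemma gcomp_in_comps: "x \<in> A \<Longrightarrow> gcomp E A x \<in> comps E A"
  by (simp add: comps_def)

lemma comps_eq_gcomp: "sym E \<Longrightarrow> C \<in> comps E A \<Longrightarrow> x \<in> C \<Longrightarrow> C = gcomp E A x"
  using gcomp_eq by (fastforce simp: comps_def)

lemma comps_eq: "sym E \<Longrightarrow> C \<in> comps E A \<Longrightarrow> D \<in> comps E A \<Longrightarrow> x \<in> C \<Longrightarrow> x \<in> D \<Longrightarrow> C = D"
  by (metis comps_eq_gcomp)

lemma Union_comps: "\<Union> (comps E A) = A"
  using gcomp_self gcomp_subset by (fastforce simp: comps_def)

lemma comps_step: "sym E \<Longrightarrow> C \<in> comps E A \<Longrightarrow> x \<in> C \<Longrightarrow> y \<in> A \<Longrightarrow> (x, y) \<in> E \<Longrightarrow> y \<in> C"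
  by (metis comps_eq_gcomp comps_subset gcomp_step subsetD)

lemma comps_least:
  assumes "sym E" "C \<in> comps E A" "x \<in> C" "x \<in> X"
    and "\<And>a b. a \<in> X \<Longrightarrow> a \<in> A \<Longrightarrow> b \<in> A \<Longrightarrow> (a, b) \<in> E \<Longrightarrow> b \<in> X"
  shows "C \<subseteq> X"
  using gcomp_least[of x X A E] comps_eq_gcomp[OF assms(1-3)] assms(4,5) by auto

lemma gcomp_Un:
  assumes "\<And>a b. a \<in> X \<Longrightarrow> b \<in> Y \<Longrightarrow> (a, b) \<notin> E" "x \<in> X"
  shows "gcomp E (X \<union> Y) x = gcomp E X x"
proof
  show "gcomp E X x \<subseteq> gcomp E (X \<union> Y) x"
    unfolding gcomp_def by (auto elim: rtrancl_mono[THEN subsetD, rotated])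
  show "gcomp E (X \<union> Y) x \<subseteq> gcomp E X x"
    using assms gcomp_subset[OF assms(2), of E]
    by (intro gcomp_least) (auto simp: gcomp_self intro: gcomp_step)
qed

lemma comps_Un:
  assumes "sym E" "\<And>a b. a \<in> X \<Longrightarrow> b \<in> Y \<Longrightarrow> (a, b) \<notin> E"
  shows "comps E (X \<union> Y) = comps E X \<union> comps E Y"
proof -
  have "gcomp E (X \<union> Y) x = gcomp E X x" if "x \<in> X" for x
    using gcomp_Un[of X Y E x] assms that by auto
  moreover have "gcomp E (X \<union> Y) x = gcomp E Y x" if "x \<in> Y" for x
    using gcomp_Un[of Y X E x] assms that by (auto simp: Un_commute dest: symD)
  ultimately show ?thesis by (auto simp: comps_def image_Un)
qed

lemma oddc_Un:
  assumes "sym E" "\<And>a b. a \<in> X \<Longrightarrow> b \<in> Y \<Longrightarrow> (a, b) \<notin> E" "X \<inter> Y = {}" "finite X" "finite Y"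
  shows "oddc E (X \<union> Y) = oddc E X + oddc E Y"
proof -
  have "odd_comps E (X \<union> Y) = odd_comps E X \<union> odd_comps E Y"
    using comps_Un[of E X Y] assms by (auto simp: odd_comps_def)
  moreover have "odd_comps E X \<inter> odd_comps E Y = {}"
    using comps_subset comps_nonempty assms(3) unfolding odd_comps_def by fastforce
  ultimately show ?thesis using assms(4,5) by (simp add: card_Un_disjoint finite_odd_comps)
qed

text \<open>From here on, connectedness of a vertex set \<open>C\<close> is expressed as
  \<open>comps E C = {C}\<close>.\<close>

lemma comps_of_comp:
  assumes "sym E" "C \<in> comps E A" shows "comps E C = {C}"
proof -
  have CA: "C \<subseteq> A" using assms comps_subset by blast
  have "comps E A = comps E C \<union> comps E (A - C)"
    using comps_Un[OF assms(1), of C "A - C"] comps_step[OF assms] CA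
    by (metis Diff_iff Un_Diff_cancel Un_absorb1)
  moreover have "C \<notin> comps E (A - C)"
    using comps_subset comps_nonempty assms(2) by fastforce
  ultimately have C: "C \<in> comps E C" using assms(2) by blast
  have "D = C" if "D \<in> comps E C" for D
    using comps_eq[OF assms(1) that C] comps_nonempty[OF that] comps_subset[OF that] by blast
  then show ?thesis using C by blast
qed

lemma comps_superset:
  assumes "sym E" "C \<in> comps E A" "C \<subseteq> B"
    and "\<And>a b. a \<in> C \<Longrightarrow> b \<in> B - C \<Longrightarrow> (a, b) \<notin> E"
  shows "C \<in> comps E B"
proof -
  have "comps E B = comps E C \<union> comps E (B - C)"
    using comps_Un[OF assms(1), of C "B - C"] assms(3,4) by (metis Un_Diff_cancel Un_absorb1)
  then show ?thesis using comps_of_comp[OF assms(1,2)] by simp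
qed

text \<open>Source of all parity arguments about barriers: even components do not affect the parity
  of the order.\<close>

lemma even_card_iff_oddc:
  assumes "sym E" "finite A" shows "even (card A) \<longleftrightarrow> even (oddc E A)"
proof -
  have "card A = (\<Sum>C\<in>comps E A. card C)"
  proof -
    have "pairwise disjnt (comps E A)"
      using comps_eq[OF assms(1), of _ A] by (auto simp: pairwise_def disjnt_def)
    moreover have "finite C" if "C \<in> comps E A" for C
      using comps_subset[OF that] assms(2) finite_subset by blast
    ultimately show ?thesis
      using card_Union_disjoint[of "comps E A"] by (simp add: Union_comps)
  qed
  then show ?thesis using even_sum_iff[of "comps E A" card] finite_comps[OF assms(2), of E]
    by (simp add: odd_comps_def)
qed

lemma oddc_comp_Diff:
  assumes "sym E" "finite A" "C \<in> comps E A"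
  shows "oddc E A = (if odd (card C) then 1 else 0) + oddc E (A - C)"
proof -
  have CA: "C \<subseteq> A" using assms comps_subset by blast
  have "oddc E (C \<union> (A - C)) = oddc E C + oddc E (A - C)"
    using comps_step[OF assms(1,3)] CA assms(2)
    by (intro oddc_Un[OF assms(1)]) (auto intro: finite_subset)
  moreover have "oddc E C = (if odd (card C) then 1 else 0)"
  proof -
    have "odd_comps E C = (if odd (card C) then {C} else {})"
      using comps_of_comp[OF assms(1,3)] by (auto simp: odd_comps_def)
    then show ?thesis by simp
  qed
  ultimately show ?thesis using CA by (simp add: Un_absorb1)
qed

section \<open>Hall's marriage theorem\<close>

text \<open>Halmos--Vaughan induction. If some proper nonempty subfamily has no surplus, its
  representatives and those of the rest can be chosen separately. Otherwise every such subfamily has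
  a surplus, and any representative of any member may be fixed first.\<close>

lemma hall:
  assumes "finite I" "\<And>i. i \<in> I \<Longrightarrow> finite (A i)" "\<And>J. J \<subseteq> I \<Longrightarrow> card J \<le> card (\<Union> (A ` J))"
  shows "\<exists>h. inj_on h I \<and> (\<forall>i\<in>I. h i \<in> A i)"
  using assms
proof (induction "card I" arbitrary: I A rule: less_induct)
  case less
  note fin = less.prems(1) and finA = less.prems(2) and hc = less.prems(3)
  consider "I = {}" | (tight) J where "J \<subset> I" "J \<noteq> {}" "card J = card (\<Union> (A ` J))"
    | (slack) "I \<noteq> {}" "\<And>J. J \<subset> I \<Longrightarrow> J \<noteq> {} \<Longrightarrow> card J < card (\<Union> (A ` J))"
    using hc by (meson le_neq_implies_less psubset_imp_subset)
  then show ?case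
  proof cases
    case 1 then show ?thesis by simp
  next
    case tight
    let ?U = "\<Union> (A ` J)"
    let ?B = "\<lambda>i. A i - ?U"
    have finJ: "finite J" using tight(1) fin finite_subset by blast
    obtain h1 where h1: "inj_on h1 J" "\<forall>i\<in>J. h1 i \<in> A i"
      using less.hyps[of J A] psubset_card_mono[OF fin tight(1)] finJ finA hc tight(1) by blast
    have "\<exists>h. inj_on h (I - J) \<and> (\<forall>i\<in>I - J. h i \<in> ?B i)"
    proof (rule less.hyps)
      show "card (I - J) < card I" using tight(1,2) fin by (intro psubset_card_mono) auto
      show "card K \<le> card (\<Union> (?B ` K))" if "K \<subseteq> I - J" for K
      proof -
        have finK: "finite K" using that fin finite_subset by blast
        have "card K + card J = card (K \<union> J)"
          using that finK finJ by (subst card_Un_disjoint) auto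
        also have "\<dots> \<le> card (\<Union> (A ` (K \<union> J)))" using that tight(1) by (intro hc) auto
        also have "\<Union> (A ` (K \<union> J)) = \<Union> (?B ` K) \<union> ?U" by auto
        also have "card \<dots> \<le> card (\<Union> (?B ` K)) + card ?U" by (rule card_Un_le)
        finally show ?thesis using tight(3) by simp
      qed
    qed (use fin finA in auto)
    then obtain h2 where h2: "inj_on h2 (I - J)" "\<forall>i\<in>I - J. h2 i \<in> ?B i" by blast
    let ?h = "\<lambda>i. if i \<in> J then h1 i else h2 i"
    have "inj_on ?h I"
    proof (rule inj_onI)
      fix i j assume ij: "i \<in> I" "j \<in> I" "?h i = ?h j"
      have "i \<in> J \<longleftrightarrow> j \<in> J" using ij h1(2) h2(2) by (metis DiffD2 DiffI UN_I)
      then show "i = j" using ij h1(1) h2(1) by (auto simp: inj_on_def split: if_splits)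
    qed
    moreover have "\<forall>i\<in>I. ?h i \<in> A i" using h1(2) h2(2) by auto
    ultimately show ?thesis by blast
  next
    case slack
    then obtain i where i: "i \<in> I" by blast
    have "card {i} \<le> card (\<Union> (A ` {i}))" using hc i by blast
    then obtain a where a: "a \<in> A i" by fastforce
    let ?B = "\<lambda>j. A j - {a}"
    have "\<exists>h. inj_on h (I - {i}) \<and> (\<forall>j\<in>I - {i}. h j \<in> ?B j)"
    proof (rule less.hyps)
      show "card (I - {i}) < card I" using i fin by (intro psubset_card_mono) auto
      show "card K \<le> card (\<Union> (?B ` K))" if "K \<subseteq> I - {i}" for K
      proof (cases "K = {}")
        case False
        then have "card K < card (\<Union> (A ` K))" using slack(2) that i by blast
        moreover have "\<Union> (?B ` K) = \<Union> (A ` K) - {a}" by auto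
        moreover have "card (\<Union> (A ` K)) - 1 \<le> card (\<Union> (A ` K) - {a})"
          by (simp add: card_Diff_singleton_if)
        ultimately show ?thesis by simp
      qed simp
    qed (use fin finA in auto)
    then obtain h where h: "inj_on h (I - {i})" "\<forall>j\<in>I - {i}. h j \<in> ?B j" by blast
    have "inj_on (h(i := a)) I"
      using h by (auto simp: inj_on_def)
    moreover have "\<forall>j\<in>I. (h(i := a)) j \<in> A j" using h a by auto
    ultimately show ?thesis by blast
  qed
qed

section \<open>Tutte's theorem\<close>

definition perfect_matching :: "('b \<times> 'b) set \<Rightarrow> 'b set \<Rightarrow> ('b \<Rightarrow> 'b) \<Rightarrow> bool" where
  "perfect_matching E V M \<longleftrightarrow> (\<forall>x\<in>V. M x \<in> V \<and> M (M x) = x \<and> (x, M x) \<in> E)"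

text \<open>Let \<open>W\<close> be a largest set for which the condition holds with equality.
  Maximality makes every component of \<open>V - W\<close> odd and makes it satisfy the condition
  after the loss of any one vertex. Hall's theorem assigns to each component its own neighbour in
  \<open>W\<close>, and induction matches what remains of the component.\<close>

theorem tutte:
  assumes "finite V" "sym E" "\<And>W. W \<subseteq> V \<Longrightarrow> oddc E (V - W) \<le> card W"
  shows "\<exists>M. perfect_matching E V M"
  using assms(1,3)
proof (induction "card V" arbitrary: V rule: less_induct)
  case less
  note fin = less.prems(1) and tc = less.prems(2)
  show ?case
  proof (cases "V = {}")
    case True then show ?thesis by (auto simp: perfect_matching_def)
  next
    case False
    then obtain v where v: "v \<in> V" by blast
    have "even (card V)" using tc[of "{}"] even_card_iff_oddc[OF assms(2) fin] by simp
    then have "odd (card (V - {v}))" using v fin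
      by (metis card_Suc_Diff1 even_Suc)
    then have "oddc E (V - {v}) \<noteq> 0"
      using even_card_iff_oddc[OF assms(2), of "V - {v}"] fin by (metis even_zero finite_Diff)
    then have bv: "oddc E (V - {v}) = card {v}" using tc[of "{v}"] v by simp
    let ?P = "\<lambda>W. W \<subseteq> V \<and> oddc E (V - W) = card W"
    have "\<exists>W. ?P W \<and> (\<forall>W'. ?P W' \<longrightarrow> card W' \<le> card W)"
      using bv v card_mono[OF fin] by (intro ex_has_greatest_nat[of ?P "{v}" _ "Suc (card V)"])
        (auto simp: less_Suc_eq_le)
    then obtain W where W: "W \<subseteq> V" "oddc E (V - W) = card W"
      and max: "\<And>W'. W' \<subseteq> V \<Longrightarrow> oddc E (V - W') = card W' \<Longrightarrow> card W' \<le> card W" by blast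
    have finW: "finite W" using W(1) fin finite_subset by blast
    have finD: "finite (V - W)" using fin by simp
    \<comment> \<open>The summand 1 for even \<open>C\<close> lets one estimate serve twice: with
      \<open>X = {}\<close> it excludes even components, and for odd \<open>C\<close> it is Tutte's
      condition for \<open>C - {x}\<close>.\<close>
    have key: "oddc E (C - insert x X) + (if odd (card C) then 0 else 1) \<le> card X"
      if C: "C \<in> comps E (V - W)" and x: "x \<in> C" and X: "X \<subseteq> C - {x}" for C x X
    proof -
      have CV: "C \<subseteq> V - W" using C comps_subset by blast
      have finC: "finite C" using CV finD finite_subset by blast
      have finX: "finite X" using X finC by (auto intro: finite_subset)
      let ?W = "W \<union> insert x X"
      have sub: "?W \<subseteq> V" using W(1) x X CV by auto
      have xX: "x \<notin> X" using X by blast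
      have cW: "card ?W = card W + card X + 1"
      proof -
        have "card ?W = card W + card (insert x X)"
          using finW finX x X CV by (intro card_Un_disjoint) auto
        then show ?thesis using finX xX by simp
      qed
      have "V - ?W = (C - insert x X) \<union> (V - W - C)" using x X CV by auto
      then have o: "oddc E (V - ?W) = oddc E (C - insert x X) + oddc E (V - W - C)"
        using comps_step[OF assms(2) C] finC finD
        by (simp only:, intro oddc_Un[OF assms(2)]) auto
      have oW: "card W = (if odd (card C) then 1 else 0) + oddc E (V - W - C)"
        using oddc_comp_Diff[OF assms(2) finD C] W(2) by simp
      have "card (C - insert x X) + (card X + 1) = card C"
      proof -
        have "card (C - insert x X) = card C - card (insert x X)" 
          using x X finX by (intro card_Diff_subset) auto
        moreover have "card (insert x X) \<le> card C" using x X finC by (intro card_mono) auto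
        moreover have "card (insert x X) = card X + 1" using xX finX by simp
        ultimately show ?thesis by simp
      qed
      then have par: "even (oddc E (C - insert x X)) \<longleftrightarrow> (odd (card C) \<longleftrightarrow> even (card X))"
        using even_card_iff_oddc[OF assms(2), of "C - insert x X"] finC
        by (metis even_add even_Suc Suc_eq_plus1 finite_Diff)
      \<comment> \<open>Maximality rules out equality for the larger set, which bounds the left side
        of the claim by \<open>card X + 1\<close>; parity then excludes this last value.\<close>
      have ne: "oddc E (V - ?W) \<noteq> card ?W" using max[OF sub] cW by linarith
      have le: "oddc E (V - ?W) \<le> card ?W" using tc[OF sub] .
      have "oddc E (C - insert x X) + (if odd (card C) then 0 else 1) < card X + 2"
        using ne le o oW cW by (auto split: if_splits)
      moreover have "oddc E (C - insert x X) + (if odd (card C) then 0 else 1) \<noteq> card X + 1"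
        using par by auto
      ultimately show ?thesis by linarith
    qed
    have oddC: "odd (card C)" if "C \<in> comps E (V - W)" for C
      using key[OF that, of _ "{}"] comps_nonempty[OF that] by (auto split: if_splits)
    define \<C> where "\<C> = comps E (V - W)"
    have fin\<C>: "finite \<C>" using finD finite_comps \<C>_def by blast
    have card\<C>: "card \<C> = card W"
      using W(2) oddC unfolding \<C>_def odd_comps_def by (metis (mono_tags, lifting) Collect_cong Collect_mem_eq)
    define N where "N C = {w \<in> W. \<exists>c\<in>C. (w, c) \<in> E}" for C
    have "\<exists>h. inj_on h \<C> \<and> (\<forall>C\<in>\<C>. h C \<in> N C)"
    proof (rule hall[OF fin\<C>])
      show "finite (N C)" for C using finW by (simp add: N_def)
      \<comment> \<open>Hall's condition for \<open>\<J>\<close> is Tutte's condition for its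
        neighbourhood \<open>?X\<close>: the members of \<open>\<J>\<close> are still odd components
        when only \<open>?X\<close> is deleted.\<close>
      fix \<J> assume J: "\<J> \<subseteq> \<C>"
      let ?X = "\<Union> (N ` \<J>)"
      have X: "?X \<subseteq> V" "?X \<subseteq> W" using W(1) by (auto simp: N_def)
      have "C \<in> odd_comps E (V - ?X)" if "C \<in> \<J>" for C
      proof -
        have C: "C \<in> comps E (V - W)" using that J \<C>_def by blast
        have "C \<in> comps E (V - ?X)"
        proof (rule comps_superset[OF assms(2) C])
          show "C \<subseteq> V - ?X" using comps_subset[OF C] X by blast
          fix a b assume ab: "a \<in> C" "b \<in> V - ?X - C"
          show "(a, b) \<notin> E"
          proof
            assume e: "(a, b) \<in> E"
            then have "b \<in> W" using comps_step[OF assms(2) C ab(1)] ab(2) by blast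
            then have "b \<in> N C" using e ab(1) symD[OF assms(2)] by (auto simp: N_def)
            then show False using that ab by blast
          qed
        qed
        then show ?thesis using oddC[OF C] by (simp add: odd_comps_def)
      qed
      then have "card \<J> \<le> oddc E (V - ?X)"
        using finite_odd_comps[of "V - ?X"] fin by (intro card_mono) auto
      then show "card \<J> \<le> card ?X" using tc[OF X(1)] by linarith
    qed
    then obtain h where h: "inj_on h \<C>" "\<And>C. C \<in> \<C> \<Longrightarrow> h C \<in> N C" by blast
    have him: "h ` \<C> = W"
      using h card\<C> finW by (intro card_subset_eq) (auto simp: card_image N_def)
    define c where "c C = (SOME c. c \<in> C \<and> (h C, c) \<in> E)" for C
    have c: "c C \<in> C" "(h C, c C) \<in> E" if "C \<in> \<C>" for C
      using someI_ex[of "\<lambda>c. c \<in> C \<and> (h C, c) \<in> E"] h(2)[OF that] unfolding c_def N_def by blast+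
    have "\<exists>M. perfect_matching E (C - {c C}) M" if C: "C \<in> \<C>" for C
    proof (rule less.hyps)
      have CV: "C \<subseteq> V" using C comps_subset \<C>_def by blast
      show "finite (C - {c C})" using CV fin by (auto intro: finite_subset)
      show "card (C - {c C}) < card V" using CV fin c(1)[OF C] by (intro psubset_card_mono) auto
      fix X assume "X \<subseteq> C - {c C}"
      then show "oddc E (C - {c C} - X) \<le> card X"
        using key[of C "c C" X] C c(1)[OF C] oddC by (simp add: \<C>_def Diff_insert2[symmetric])
    qed
    then obtain M where M: "\<And>C. C \<in> \<C> \<Longrightarrow> perfect_matching E (C - {c C}) (M C)" by metis
    define co where "co x = gcomp E (V - W) x" for x
    have co: "co x \<in> \<C>" "x \<in> co x" if "x \<in> V - W" for x
      using gcomp_in_comps[OF that, of E] gcomp_self[of x E] by (simp_all add: co_def \<C>_def)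
    have co_eq: "co x = C" if "C \<in> \<C>" "x \<in> C" for x C
      using comps_eq_gcomp[OF assms(2), of C "V - W" x] that by (simp add: co_def \<C>_def)
    define g where "g = inv_into \<C> h"
    have g: "g w \<in> \<C>" "h (g w) = w" if "w \<in> W" for w
      using inv_into_into[of w h \<C>] f_inv_into_f[of w h \<C>] that him by (simp_all add: g_def)
    have gh: "g (h C) = C" if "C \<in> \<C>" for C using that h(1) by (simp add: g_def)
    have hW: "h C \<in> W" if "C \<in> \<C>" for C using him that by blast
    define MM where "MM x = (if x \<in> W then c (g x) else if x = c (co x) then h (co x) else M (co x) x)" for x
    have sub: "C \<subseteq> V - W" if "C \<in> \<C>" for C using that comps_subset \<C>_def by blast
    have "MM x \<in> V \<and> MM (MM x) = x \<and> (x, MM x) \<in> E" if x: "x \<in> V" for x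
    proof (cases "x \<in> W")
      case True
      have cx: "c (g x) \<in> g x" "c (g x) \<in> V - W" using c(1) sub g(1)[OF True] by blast+
      have "co (c (g x)) = g x" using co_eq g(1)[OF True] cx(1) by blast
      then show ?thesis using True cx g[OF True] c(2)[OF g(1)[OF True]] by (simp add: MM_def)
    next
      case False
      then have xD: "x \<in> V - W" using x by blast
      show ?thesis
      proof (cases "x = c (co x)")
        case True
        then have "MM x = h (co x)" using False by (simp add: MM_def)
        then show ?thesis using hW[OF co(1)[OF xD]] gh[OF co(1)[OF xD]] True W(1)
            c(2)[OF co(1)[OF xD]] symD[OF assms(2)] by (auto simp: MM_def)
      next
        case neq: False
        let ?C = "co x"
        have m: "M ?C x \<in> ?C - {c ?C}" "M ?C (M ?C x) = x" "(x, M ?C x) \<in> E"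
          using M[OF co(1)[OF xD]] co(2)[OF xD] neq by (auto simp: perfect_matching_def)
        have "co (M ?C x) = ?C" using co_eq[OF co(1)[OF xD]] m(1) by blast
        moreover have "M ?C x \<in> V - W" using m(1) sub[OF co(1)[OF xD]] by blast
        ultimately show ?thesis using m False neq by (auto simp: MM_def)
      qed
    qed
    then have "perfect_matching E V MM" by (auto simp: perfect_matching_def)
    then show ?thesis by blast
  qed
qed

text \<open>Passing to a smallest barrier gives the rigidity that replaces the usual clean-up of barriers.\<close>

lemma minimal_barrier:
  assumes "finite V" "sym E" "\<nexists>M. perfect_matching E V M"
  obtains W where "W \<subseteq> V" "oddc E (V - W) > card W"
    "\<And>w C D. w \<in> W \<Longrightarrow> C \<in> comps E (V - W) \<Longrightarrow> D \<in> comps E (V - W) \<Longrightarrow>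
       \<exists>y \<in> V - W. (w, y) \<in> E \<and> y \<notin> C \<union> D"
proof -
  let ?P = "\<lambda>W. W \<subseteq> V \<and> oddc E (V - W) > card W"
  have "\<exists>W. ?P W" using tutte[OF assms(1,2)] assms(3) by (meson not_le)
  then have "\<exists>W. ?P W \<and> (\<forall>W'. ?P W' \<longrightarrow> card W \<le> card W')"
    by (elim exE) (rule ex_has_least_nat)
  then obtain W where W: "W \<subseteq> V" "oddc E (V - W) > card W"
    and min: "\<And>W'. ?P W' \<Longrightarrow> card W \<le> card W'" by auto
  have "\<exists>y \<in> V - W. (w, y) \<in> E \<and> y \<notin> C \<union> D"
    if w: "w \<in> W" and C: "C \<in> comps E (V - W)" and D: "D \<in> comps E (V - W)" for w C D
  proof (rule ccontr)
    assume neg: "\<not> ?thesis"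
    \<comment> \<open>Otherwise putting \<open>w\<close> back merges it with \<open>C\<close> and
      \<open>D\<close> at most. That costs at most two odd components while \<open>W\<close> shrinks
      by one, and the change of parity supplies the missing unit: \<open>W - {w}\<close> would be a
      smaller barrier.\<close>
    let ?A = "V - W" and ?R = "V - W - (C \<union> D)" and ?B = "insert w (C \<union> D)"
    have fin: "finite W" "finite ?A" "finite ?R" using assms(1) W(1) finite_subset by auto
    have CD: "C \<subseteq> ?A" "D \<subseteq> ?A" using C D comps_subset by blast+
    have finCD: "finite (C \<union> D)" using CD fin(2) finite_subset by blast
    have eq: "V - (W - {w}) = ?B \<union> ?R" using w W(1) CD by auto
    have "oddc E (?B \<union> ?R) = oddc E ?B + oddc E ?R"
      using neg comps_step[OF assms(2) C] comps_step[OF assms(2) D] w finCD fin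
      by (intro oddc_Un[OF assms(2)]) auto
    then have o1: "oddc E (V - (W - {w})) \<ge> oddc E ?R" using eq by simp
    have "comps E (C \<union> D \<union> ?R) = comps E (C \<union> D) \<union> comps E ?R"
      using comps_step[OF assms(2) C] comps_step[OF assms(2) D]
      by (intro comps_Un[OF assms(2)]) auto
    moreover have "C \<union> D \<union> ?R = ?A" using CD by auto
    ultimately have spl: "comps E ?A = comps E (C \<union> D) \<union> comps E ?R" by simp
    have "X \<in> {C, D} \<union> comps E ?R" if X: "X \<in> comps E ?A" for X
    proof (cases "X \<in> comps E ?R")
      case False
      then have "X \<in> comps E (C \<union> D)" using X spl by blast
      then obtain x where "x \<in> X" "x \<in> C \<union> D" using comps_nonempty comps_subset by blast
      then have "X = C \<or> X = D" using comps_eq[OF assms(2) X C] comps_eq[OF assms(2) X D] by blast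
      then show ?thesis by blast
    qed simp
    then have "comps E ?A \<subseteq> {C, D} \<union> comps E ?R" by blast
    then have "odd_comps E ?A \<subseteq> {C, D} \<union> odd_comps E ?R" by (auto simp: odd_comps_def)
    then have "oddc E ?A \<le> card ({C, D} \<union> odd_comps E ?R)"
      using finite_odd_comps[OF fin(3)] by (intro card_mono) auto
    also have "\<dots> \<le> card {C, D} + oddc E ?R" by (rule card_Un_le)
    also have "\<dots> \<le> 2 + oddc E ?R" using card_insert_le_m1[of 2 "{D}" C] by simp
    finally have o2: "oddc E ?A \<le> 2 + oddc E ?R" .
    have "V - (W - {w}) = insert w ?A" using w W(1) by auto
    then have "card (V - (W - {w})) = Suc (card ?A)" using w fin by simp
    then have par: "even (oddc E (V - (W - {w}))) \<longleftrightarrow> odd (oddc E ?A)"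
      using even_card_iff_oddc[OF assms(2)] assms(1) by (metis even_Suc finite_Diff)
    have cW: "card W = Suc (card (W - {w}))" using w fin(1) by (metis card_Suc_Diff1)
    have "oddc E (V - (W - {w})) \<ge> card (W - {w})" using o1 o2 W(2) cW by linarith
    moreover have "oddc E (V - (W - {w})) \<noteq> card (W - {w})"
      using par o1 o2 W(2) cW by (cases "oddc E ?A = Suc (card W)") auto
    ultimately show False using min[of "W - {w}"] W(1) cW by auto
  qed
  then show thesis using that W by blast
qed

section \<open>Factors of prescribed degree and parity\<close>

lemma card_sym_irrefl:
  assumes "finite E" "sym E" "irrefl E"
  shows "card E = 2 * card ((\<lambda>(u, v). {u, v}) ` E)"
proof -
  let ?p = "\<lambda>(u, v). {u, v}"
  have "card E = (\<Sum>e\<in>E. 1)" by simp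
  also have "\<dots> = (\<Sum>y\<in>?p ` E. \<Sum>e\<in>{e \<in> E. ?p e = y}. 1)"
    by (rule sum.image_gen[OF assms(1)])
  also have "\<dots> = (\<Sum>y\<in>?p ` E. 2)"
  proof (rule sum.cong[OF refl])
    fix y assume "y \<in> ?p ` E"
    then obtain u v where uv: "(u, v) \<in> E" "y = {u, v}" by auto
    have "u \<noteq> v" using uv assms(3) by (auto simp: irrefl_def)
    moreover have "{e \<in> E. ?p e = y} = {(u, v), (v, u)}"
      using uv symD[OF assms(2)] by (auto simp: doubleton_eq_iff)
    ultimately show "(\<Sum>e\<in>{e \<in> E. ?p e = y}. 1) = (2::nat)" by simp
  qed
  finally show ?thesis by simp
qed

text \<open>\<open>Inl (v, i)\<close> is the \<open>i\<close>-th copy of \<open>v\<close> and \<open>Inr (u, v)\<close> the end at \<open>u\<close> of the edge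
  \<open>{u, v}\<close>. The edge belongs to the factor iff its ends are matched with copies rather than with each
  other. Matching the first two copies of \<open>v \<in> L\<close> with each other lowers the degree at \<open>v\<close> by two.\<close>

fun gadget_adj :: "'a set \<Rightarrow> ('a \<times> nat) + ('a \<times> 'a) \<Rightarrow> ('a \<times> nat) + ('a \<times> 'a) \<Rightarrow> bool" where
  "gadget_adj L (Inl (u, i)) (Inl (v, j)) \<longleftrightarrow> u = v \<and> u \<in> L \<and> i + j = 1"
| "gadget_adj L (Inl (u, i)) (Inr (a, b)) \<longleftrightarrow> u = a"
| "gadget_adj L (Inr (a, b)) (Inl (u, i)) \<longleftrightarrow> u = a"
| "gadget_adj L (Inr (a, b)) (Inr (c, d)) \<longleftrightarrow> a = d \<and> b = c"

definition gadget_edges :: "'a set \<Rightarrow> ((('a \<times> nat) + ('a \<times> 'a)) \<times> (('a \<times> nat) + ('a \<times> 'a))) set" where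
  "gadget_edges L = {(x, y). gadget_adj L x y}"

definition gadget_nodes :: "'a set \<Rightarrow> ('a \<times> 'a) set \<Rightarrow> ('a \<Rightarrow> nat) \<Rightarrow> (('a \<times> nat) + ('a \<times> 'a)) set" where
  "gadget_nodes V E f = Inl ` (SIGMA v:V. {..<f v}) \<union> Inr ` E"

lemma gadget_adj_sym: "gadget_adj L x y \<Longrightarrow> gadget_adj L y x"
  by (induction L x y rule: gadget_adj.induct) auto

lemma sym_gadget_edges: "sym (gadget_edges L)"
  using gadget_adj_sym by (auto simp: sym_def gadget_edges_def)

lemma gadget_adj_Inl_iff:
  "gadget_adj L (Inl (u, i)) y \<longleftrightarrow>
     (\<exists>v. y = Inr (u, v)) \<or> (u \<in> L \<and> (\<exists>j. i + j = 1 \<and> y = Inl (u, j)))"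
  by (cases "(L, Inl (u, i) :: ('a \<times> nat) + ('a \<times> 'a), y)" rule: gadget_adj.cases) auto

lemma gadget_adj_Inr_iff:
  "gadget_adj L (Inr (u, v)) y \<longleftrightarrow> y = Inr (v, u) \<or> (\<exists>i. y = Inl (u, i))"
  by (cases "(L, Inr (u, v) :: ('a \<times> nat) + ('a \<times> 'a), y)" rule: gadget_adj.cases) auto

text \<open>The copies of \<open>v\<close> matched with edge ends (\<open>A\<close>) correspond to
  the factor edges at \<open>v\<close>. The others (\<open>B\<close>) are matched among themselves,
  which the gadget allows only for the copies 0 and 1 of some \<open>v\<close> in \<open>L\<close>;
  so \<open>B\<close> is empty or costs exactly two.\<close>

lemma factor_of_gadget_matching:
  fixes f :: "'a \<Rightarrow> nat"
  assumes "finite V" "E \<subseteq> V \<times> V" "sym E"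
    and pm: "perfect_matching (gadget_edges L) (gadget_nodes V E f) M"
  shows "\<exists>F\<subseteq>E. sym F \<and>
    (\<forall>v\<in>V. card (F `` {v}) = f v \<or> v \<in> L \<and> card (F `` {v}) + 2 = f v)"
proof -
  let ?N = "gadget_nodes V E f"
  have M: "M x \<in> ?N" "M (M x) = x" "gadget_adj L x (M x)" if "x \<in> ?N" for x
    using pm that by (auto simp: perfect_matching_def gadget_edges_def)
  have NInl: "Inl (v, i) \<in> ?N \<longleftrightarrow> v \<in> V \<and> i < f v" for v i
    by (auto simp: gadget_nodes_def)
  have NInr: "Inr e \<in> ?N \<longleftrightarrow> e \<in> E" for e
    by (auto simp: gadget_nodes_def)
  define F where "F = {(u, v) \<in> E. \<exists>i. M (Inr (u, v)) = Inl (u, i)}"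
  have "(v, u) \<in> F" if "(u, v) \<in> F" for u v
  proof -
    have e: "(u, v) \<in> E" "(v, u) \<in> E" using that symD[OF assms(3)] by (auto simp: F_def)
    have "M (Inr (v, u)) \<noteq> Inr (u, v)"
      using M(2)[of "Inr (v, u)"] that e by (auto simp: F_def NInr)
    then show ?thesis using M(3)[of "Inr (v, u)"] e by (auto simp: F_def NInr gadget_adj_Inr_iff)
  qed
  then have symF: "sym F" by (auto simp: sym_def)
  have "card (F `` {v}) = f v \<or> v \<in> L \<and> card (F `` {v}) + 2 = f v" if v: "v \<in> V" for v
  proof -
    define A where "A = {i. i < f v \<and> (\<exists>w. M (Inl (v, i)) = Inr (v, w))}"
    define B where "B = {i. i < f v \<and> (\<exists>j. M (Inl (v, i)) = Inl (v, j))}"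
    have AB: "A \<union> B = {..<f v}" "A \<inter> B = {}"
      using M(3)[of "Inl (v, _)"] v by (auto simp: A_def B_def NInl gadget_adj_Inl_iff)
    have "finite A" "finite B" by (auto simp: A_def B_def)
    then have cAB: "card A + card B = f v"
      using card_Un_disjoint[of A B] AB by simp
    have "bij_betw (\<lambda>i. snd (projr (M (Inl (v, i))))) A (F `` {v})"
    proof (rule bij_betw_byWitness[where f' = "\<lambda>w. snd (projl (M (Inr (v, w))))"])
      show "\<forall>i\<in>A. snd (projl (M (Inr (v, snd (projr (M (Inl (v, i)))))))) = i"
        using M(2)[of "Inl (v, _)"] v by (fastforce simp: A_def NInl)
      show "\<forall>w\<in>F `` {v}. snd (projr (M (Inl (v, snd (projl (M (Inr (v, w)))))))) = w"
        using M(2)[of "Inr (v, _)"] by (fastforce simp: F_def NInr)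
      show "(\<lambda>i. snd (projr (M (Inl (v, i))))) ` A \<subseteq> F `` {v}"
      proof clarify
        fix i assume "i \<in> A"
        then obtain w where "i < f v" "M (Inl (v, i)) = Inr (v, w)" by (auto simp: A_def)
        then show "(v, snd (projr (M (Inl (v, i))))) \<in> F"
          using M(1,2)[of "Inl (v, i)"] v by (auto simp: F_def NInl NInr)
      qed
      show "(\<lambda>w. snd (projl (M (Inr (v, w))))) ` (F `` {v}) \<subseteq> A"
      proof clarify
        fix w assume "(v, w) \<in> F"
        then obtain i where "(v, w) \<in> E" "M (Inr (v, w)) = Inl (v, i)" by (auto simp: F_def)
        then show "snd (projl (M (Inr (v, w)))) \<in> A"
          using M(1,2)[of "Inr (v, w)"] v by (auto simp: A_def NInl NInr)
      qed
    qed
    then have cF: "card (F `` {v}) = card A" by (simp add: bij_betw_same_card)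
    have Bsub: "v \<in> L \<and> 1 - i \<in> B \<and> i < 2" if i: "i \<in> B" for i
    proof -
      obtain j where j: "i < f v" "M (Inl (v, i)) = Inl (v, j)"
        using i by (auto simp: B_def)
      have ij: "v \<in> L" "i + j = 1"
        using M(3)[of "Inl (v, i)"] j v by (auto simp: NInl)
      moreover have "j \<in> B"
        using M(1,2)[of "Inl (v, i)"] j v by (auto simp: NInl B_def)
      moreover have "j = 1 - i" using ij by simp
      ultimately show ?thesis by auto
    qed
    consider "B = {}" | "v \<in> L" "B = {0, 1}"
    proof (cases "B = {}")
      case False
      then obtain i where i: "i \<in> B" by blast
      have "{0, 1} = {i, 1 - i}" using Bsub[OF i] by (cases "i = 0") auto
      then have "{0, 1} \<subseteq> B" using Bsub[OF i] i by (metis empty_subsetI insert_subset)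
      moreover have "B \<subseteq> {0, 1}" using Bsub by force
      ultimately show ?thesis using that(2) Bsub[OF i] by blast
    qed (use that in blast)
    then show ?thesis using cAB cF by cases auto
  qed
  then show ?thesis using symF by (intro exI[of _ F]) (auto simp: F_def)
qed

section \<open>Barriers for factors\<close>

text \<open>For \<open>L = {}\<close> this is the hard half of Tutte's f-factor theorem; in general
  it is a case of Lovasz's parity factor theorem with lower bound \<open>f - 2\<close> on
  \<open>L\<close>. Edges inside \<open>K\<close> count twice in
  \<open>card (E \<inter> K \<times> V)\<close>, so the parity tested is the usual one, that of the
  sum of \<open>f\<close> over \<open>K\<close> plus the number of edges between \<open>K\<close>
  and \<open>T\<close>. In the gadget, \<open>S\<close> consists of the vertices whose copies lie in
  the barrier, \<open>T\<close> of those whose edge ends do.\<close>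

theorem parity_factor:
  fixes f :: "'a \<Rightarrow> nat" and V :: "'a set"
  assumes fin: "finite V" and EV: "E \<subseteq> V \<times> V" and sym: "sym E" and irr: "irrefl E"
    and noiso: "\<And>v. v \<in> V \<Longrightarrow> E `` {v} \<noteq> {}"
    and f1: "\<And>v. v \<in> V \<Longrightarrow> f v \<ge> 1" and f2: "\<And>v. v \<in> L \<Longrightarrow> f v \<ge> 2"
    and even: "even (\<Sum>v\<in>V. f v)"
    and nofac: "\<not> (\<exists>F\<subseteq>E. sym F \<and>
      (\<forall>v\<in>V. card (F `` {v}) = f v \<or> v \<in> L \<and> card (F `` {v}) + 2 = f v))"
  obtains S T where "S \<subseteq> V" "T \<subseteq> V" "S \<inter> T = {}"
    "(\<Sum>v\<in>S. f v) + card (E \<inter> T \<times> V) + 2 \<le>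
       (\<Sum>v\<in>T. if v \<in> L then f v - 2 else f v) + card (E \<inter> S \<times> T)
       + card {K \<in> comps E (V - S - T).
           odd ((\<Sum>v\<in>K. f v) + card (E \<inter> K \<times> V) + card (E \<inter> S \<times> K))}"
proof -
  let ?N = "gadget_nodes V E f" and ?G = "gadget_edges L"
  have finE: "finite E" using fin EV finite_subset by blast
  have finN: "finite ?N" using fin finE by (auto simp: gadget_nodes_def)
  have NInl: "Inl (v, i) \<in> ?N \<longleftrightarrow> v \<in> V \<and> i < f v" for v i
    by (auto simp: gadget_nodes_def)
  have NInr: "Inr e \<in> ?N \<longleftrightarrow> e \<in> E" for e
    by (auto simp: gadget_nodes_def)
  have nopm: "\<nexists>M. perfect_matching ?G ?N M"
    using factor_of_gadget_matching[OF fin EV sym] nofac by blast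
  obtain W where W: "W \<subseteq> ?N" "oddc ?G (?N - W) > card W"
    and minW: "\<And>w C D. w \<in> W \<Longrightarrow> C \<in> comps ?G (?N - W) \<Longrightarrow> D \<in> comps ?G (?N - W) \<Longrightarrow>
       \<exists>y \<in> ?N - W. (w, y) \<in> ?G \<and> y \<notin> C \<union> D"
    using minimal_barrier[OF finN sym_gadget_edges nopm] by blast
  define Q where "Q = ?N - W"
  have adjG: "(x, y) \<in> ?G \<longleftrightarrow> gadget_adj L x y" for x y by (simp add: gadget_edges_def)
  define co where "co x = gcomp ?G Q x" for x
  have co: "co x \<in> comps ?G Q" "x \<in> co x" if "x \<in> Q" for x
    using gcomp_in_comps[OF that] gcomp_self by (auto simp: co_def)
  have step: "y \<in> C" if "C \<in> comps ?G Q" "x \<in> C" "y \<in> Q" "gadget_adj L x y" for C x y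
    using comps_step[OF sym_gadget_edges that(1-3)] that(4) by (simp add: adjG)
  have minW': "\<exists>y \<in> Q. gadget_adj L w y \<and> y \<notin> C \<and> y \<notin> D"
    if "w \<in> W" "C \<in> comps ?G Q" "D \<in> comps ?G Q" for w C D
    using minW[OF that[unfolded Q_def]] by (auto simp: adjG Q_def)
  have twins: "Inl (v, j) \<in> W" if v: "v \<in> V" "Inl (v, i) \<in> W" "j < f v" for v i j
  proof (rule ccontr)
    assume nj: "Inl (v, j) \<notin> W"
    then have jQ: "Inl (v, j) \<in> Q" using that by (auto simp: Q_def NInl)
    \<comment> \<open>Outside \<open>W\<close>, copy \<open>i\<close> sees only edge ends at
      \<open>v\<close>, which lie in the component of copy \<open>j\<close>, and possibly its
      partner \<open>1 - i\<close>. These two components would exhaust its neighbours. For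
      \<open>i \<ge> 2\<close> truncation gives \<open>1 - i = 0\<close>, and \<open>D\<close> is
      just some component.\<close>
    define D where "D = (if Inl (v, 1 - i) \<in> Q then co (Inl (v, 1 - i)) else co (Inl (v, j)))"
    have D: "D \<in> comps ?G Q" using co(1) jQ by (auto simp: D_def)
    obtain y where y: "y \<in> Q" "gadget_adj L (Inl (v, i)) y" "y \<notin> co (Inl (v, j))" "y \<notin> D"
      using minW'[OF v(2) co(1)[OF jQ] D] by blast
    from y(2) consider w where "y = Inr (v, w)" | k where "i + k = 1" "y = Inl (v, k)"
      unfolding gadget_adj_Inl_iff by blast
    then show False
    proof cases
      case 1
      then show False using step[OF co(1)[OF jQ] co(2)[OF jQ] y(1)] y(3) by simp
    next
      case 2
      then have "k = 1 - i" by simp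
      then show False using y co(2)[OF y(1)] 2 by (auto simp: D_def)
    qed
  qed
  define S where "S = {v \<in> V. Inl (v, 0) \<in> W}"
  define T where "T = {v \<in> V. \<exists>w. Inr (v, w) \<in> W}"
  have f0: "0 < f v" if "v \<in> V" for v using f1[OF that] by simp
  have S_iff: "Inl (v, i) \<in> W \<longleftrightarrow> v \<in> S \<and> i < f v" for v i
  proof
    assume "Inl (v, i) \<in> W"
    then show "v \<in> S \<and> i < f v" using W(1) twins[of v i 0] f0 by (auto simp: S_def NInl)
  next
    assume "v \<in> S \<and> i < f v"
    then show "Inl (v, i) \<in> W" using twins[of v 0 i] by (auto simp: S_def)
  qed
  have "odd_comps ?G Q \<noteq> {}" using W(2) by (auto simp: Q_def)
  then obtain C0 where C0: "C0 \<in> comps ?G Q" by (auto simp: odd_comps_def)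
  have T_all: "v \<notin> S \<and> (\<forall>x. (v, x) \<in> E \<longrightarrow> Inr (v, x) \<in> W)" if vw: "Inr (v, w) \<in> W" for v w
  proof -
    have e: "(v, w) \<in> E" using vw W(1) NInr by blast
    then have "v \<in> V" using EV by blast
    \<comment> \<open>An end at \<open>v\<close> sees its opposite end and the copies of
      \<open>v\<close>. \<open>C\<close> takes care of the former, with \<open>C0\<close> as a
      filler if the opposite end lies in \<open>W\<close>. The copies are absent if
      \<open>v \<in> S\<close>, and otherwise those in \<open>Q\<close> share the component of any
      surviving end at \<open>v\<close>; either way minimality of \<open>W\<close> is
      violated.\<close>
    define C where "C = (if Inr (w, v) \<in> Q then co (Inr (w, v)) else C0)"
    have C: "C \<in> comps ?G Q" using co(1) C0 by (auto simp: C_def)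
    have Cw: "Inr (w, v) \<in> C" if "Inr (w, v) \<in> Q" using co(2)[OF that] that by (simp add: C_def)
    have "v \<notin> S"
    proof
      assume "v \<in> S"
      then have "Inl (v, i) \<notin> Q" for i using S_iff NInl by (auto simp: Q_def)
      then show False using minW'[OF vw C C] Cw by (auto simp: gadget_adj_Inr_iff)
    qed
    moreover have "Inr (v, x) \<in> W" if x: "(v, x) \<in> E" for x
    proof (rule ccontr)
      assume "Inr (v, x) \<notin> W"
      then have xQ: "Inr (v, x) \<in> Q" using x by (auto simp: Q_def NInr)
      obtain y where y: "y \<in> Q" "gadget_adj L (Inr (v, w)) y" "y \<notin> C" "y \<notin> co (Inr (v, x))"
        using minW'[OF vw C co(1)[OF xQ]] by blast
      then obtain i where "y = Inl (v, i)" using Cw by (auto simp: gadget_adj_Inr_iff)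
      then show False using step[OF co(1)[OF xQ] co(2)[OF xQ] y(1)] y(4) by simp
    qed
    ultimately show ?thesis by blast
  qed
  have ST: "S \<inter> T = {}" using T_all by (auto simp: T_def)
  have T_iff: "Inr (v, w) \<in> W \<longleftrightarrow> v \<in> T \<and> (v, w) \<in> E" for v w
  proof
    assume vw: "Inr (v, w) \<in> W"
    then have "(v, w) \<in> E" using W(1) NInr by blast
    then show "v \<in> T \<and> (v, w) \<in> E" using vw EV by (auto simp: T_def)
  qed (use T_all in \<open>auto simp: T_def\<close>)
  have SV: "S \<subseteq> V" and TV: "T \<subseteq> V" by (auto simp: S_def T_def)
  have finST: "finite S" "finite T" using SV TV fin finite_subset by blast+
  define R where "R = V - S - T"
  have QInl: "Inl (v, i) \<in> Q \<longleftrightarrow> v \<in> V - S \<and> i < f v" for v i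
    by (auto simp: Q_def NInl S_iff)
  have QInr: "Inr (u, v) \<in> Q \<longleftrightarrow> (u, v) \<in> E \<and> u \<notin> T" for u v
    by (auto simp: Q_def NInr T_iff)
  have eqW: "W = Inl ` (SIGMA v:S. {..<f v}) \<union> Inr ` (E \<inter> T \<times> V)"
  proof (rule Set.set_eqI)
    fix x show "x \<in> W \<longleftrightarrow> x \<in> Inl ` (SIGMA v:S. {..<f v}) \<union> Inr ` (E \<inter> T \<times> V)"
    proof (cases x)
      case (Inl a) then show ?thesis by (cases a) (auto simp: S_iff)
    next
      case (Inr a) then show ?thesis using EV by (cases a) (auto simp: T_iff)
    qed
  qed
  have card_copies: "card (Inl ` (SIGMA v:A. {..<f v}) \<union> Inr ` B) = (\<Sum>v\<in>A. f v) + card B"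
    if "finite A" "finite B" for A and B :: "('a \<times> 'a) set"
  proof -
    have "card (Inl ` (SIGMA v:A. {..<f v}) \<union> Inr ` B)
       = card (Inl ` (SIGMA v:A. {..<f v}) :: (('a \<times> nat) + ('a \<times> 'a)) set)
         + card (Inr ` B :: (('a \<times> nat) + ('a \<times> 'a)) set)"
      using that by (intro card_Un_disjoint) auto
    then show ?thesis using that by (simp add: card_image)
  qed
  have cW: "card W = (\<Sum>v\<in>S. f v) + card (E \<inter> T \<times> V)"
    unfolding eqW using finST finE by (intro card_copies) auto
  \<comment> \<open>The part of the gadget that belongs to \<open>K\<close>. An end at a vertex of
    \<open>S\<close> facing \<open>K\<close> has lost its copies to \<open>W\<close> and hangs on
    its opposite end alone; this is the origin of the term
    \<open>card (E \<inter> S \<times> K)\<close> in the parity.\<close>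
  define D where "D K = Inl ` (SIGMA v:K. {..<f v}) \<union> Inr ` ((E \<inter> K \<times> V) \<union> (E \<inter> S \<times> K))" for K
  have cD: "card (D K) = (\<Sum>v\<in>K. f v) + card (E \<inter> K \<times> V) + card (E \<inter> S \<times> K)"
    if "K \<subseteq> R" for K
  proof -
    have "finite K" using that fin finite_subset[of K V] by (auto simp: R_def)
    then have "card (D K) = (\<Sum>v\<in>K. f v) + card ((E \<inter> K \<times> V) \<union> (E \<inter> S \<times> K))"
      unfolding D_def using finE by (intro card_copies) auto
    also have "card ((E \<inter> K \<times> V) \<union> (E \<inter> S \<times> K)) = card (E \<inter> K \<times> V) + card (E \<inter> S \<times> K)"
      using finE that by (intro card_Un_disjoint) (auto simp: R_def)
    finally show ?thesis by simp
  qed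
  \<comment> \<open>Copies at \<open>T\<close> have lost all edge ends and are isolated, except that
    for \<open>v \<in> L\<close> the copies 0 and 1 form an even component; this yields
    \<open>f v - 2\<close>. Ends at \<open>S\<close> facing \<open>T\<close> have lost all
    neighbours.\<close>
  define \<T> where "\<T> = (\<lambda>a. {Inl a :: ('a \<times> nat) + ('a \<times> 'a)}) ` (SIGMA v:T. {i. i < f v \<and> (v \<in> L \<longrightarrow> i \<ge> 2)})"
  define \<S> where "\<S> = (\<lambda>e. {Inr e :: ('a \<times> nat) + ('a \<times> 'a)}) ` (E \<inter> S \<times> T)"
  define \<K> where "\<K> = {K \<in> comps E R. odd (card (D K))}"
  have "C \<in> \<T> \<union> \<S> \<union> D ` \<K>" if "C \<in> odd_comps ?G Q" for C
  proof -
    have C: "C \<in> comps ?G Q" and odd: "odd (card C)" using that by (auto simp: odd_comps_def)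
    have CQ: "C \<subseteq> Q" using comps_subset[OF C] .
    have least: "C \<subseteq> X" if "x \<in> C" "x \<in> X"
      "\<And>a b. a \<in> X \<Longrightarrow> a \<in> Q \<Longrightarrow> b \<in> Q \<Longrightarrow> gadget_adj L a b \<Longrightarrow> b \<in> X" for x X
      using comps_least[OF sym_gadget_edges C that(1,2)] that(3) by (auto simp: adjG)
    consider (t) v i where "Inl (v, i) \<in> C" "v \<in> T" | (r) v i where "Inl (v, i) \<in> C" "v \<notin> T"
      | (s) "\<And>v i. Inl (v, i) \<notin> C" by blast
    then show ?thesis
    proof cases
      case t
      have vi: "v \<in> V" "i < f v" using t(1) CQ QInl by blast+
      define X :: "(('a \<times> nat) + ('a \<times> 'a)) set" where
        "X = {Inl (v, j) |j. j = i \<or> v \<in> L \<and> i + j = 1}"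
      have CX: "C \<subseteq> X"
      proof (rule least[OF t(1)])
        show "Inl (v, i) \<in> X" by (simp add: X_def)
        fix a b assume a: "a \<in> X" and b: "b \<in> Q" and ab: "gadget_adj L a b"
        obtain j where j: "a = Inl (v, j)" "j = i \<or> v \<in> L \<and> i + j = 1" using a by (auto simp: X_def)
        have "b \<noteq> Inr (v, w)" for w using b QInr t(2) by auto
        then obtain k where "v \<in> L" "j + k = 1" "b = Inl (v, k)"
          using ab unfolding j(1) gadget_adj_Inl_iff by blast
        then show "b \<in> X" using j(2) by (auto simp: X_def)
      qed
      have "\<not> (v \<in> L \<and> i < 2)"
      proof
        assume vL: "v \<in> L \<and> i < 2"
        have "Inl (v, 1 - i) \<in> Q" using vL f2[of v] t(1) CQ QInl by fastforce
        then have "Inl (v, 1 - i) \<in> C" using step[OF C t(1)] vL by auto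
        moreover have "X \<subseteq> {Inl (v, i), Inl (v, 1 - i)}" by (auto simp: X_def)
        ultimately have "C = {Inl (v, i), Inl (v, 1 - i)}" using CX t(1) by blast
        moreover have "i \<noteq> 1 - i" by presburger
        ultimately show False using odd by auto
      qed
      then have "C = {Inl (v, i)}" using CX t(1) by (auto simp: X_def)
      then show ?thesis using vi t(2) \<open>\<not> (v \<in> L \<and> i < 2)\<close> by (auto simp: \<T>_def)
    next
      case r
      have v: "v \<in> R" "i < f v" using r CQ QInl by (auto simp: R_def)
      define K where "K = gcomp E R v"
      have K: "K \<in> comps E R" "v \<in> K" using gcomp_in_comps[OF v(1)] gcomp_self by (auto simp: K_def)
      have KR: "K \<subseteq> R" using comps_subset[OF K(1)] .
      have "C \<subseteq> D K"
      proof (rule least[OF r(1)])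
        show "Inl (v, i) \<in> D K" using K(2) v(2) by (auto simp: D_def)
        fix a b assume a: "a \<in> D K" "a \<in> Q" and b: "b \<in> Q" and ab: "gadget_adj L a b"
        from a(1) consider w j where "a = Inl (w, j)" "w \<in> K"
          | w x where "a = Inr (w, x)" "w \<in> K" "(w, x) \<in> E"
          | s w where "a = Inr (s, w)" "s \<in> S" "w \<in> K" "(s, w) \<in> E"
          by (auto simp: D_def)
        then show "b \<in> D K"
        proof cases
          case 1
          from ab[unfolded 1(1) gadget_adj_Inl_iff] show ?thesis
            using b 1(2) QInr QInl EV by (auto simp: D_def)
        next
          case 2
          from ab[unfolded 2(1) gadget_adj_Inr_iff] show ?thesis
          proof
            assume bx: "b = Inr (x, w)"
            then have x: "x \<notin> T" "(x, w) \<in> E" using b QInr by blast+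
            have "x \<in> S \<or> x \<in> K"
              using comps_step[OF sym K(1) 2(2) _ 2(3)] x EV by (auto simp: R_def)
            then show ?thesis using x bx 2(2) KR EV by (auto simp: D_def)
          next
            assume "\<exists>i. b = Inl (w, i)"
            then show ?thesis using b QInl 2(2) by (auto simp: D_def)
          qed
        next
          case 3
          from ab[unfolded 3(1) gadget_adj_Inr_iff] show ?thesis
            using b 3 QInl symD[OF sym 3(4)] EV by (auto simp: D_def)
        qed
      qed
      moreover have "D K \<subseteq> C"
      proof -
        \<comment> \<open>All copies of a vertex of \<open>R\<close> are adjacent to each of its
          edge ends. As no vertex is isolated, the copies stay together, and as each vertex has a
          copy, membership in \<open>C\<close> spreads along the edges of \<open>K\<close>.\<close>
        define Y where "Y = {w \<in> R. \<forall>j<f w. Inl (w, j) \<in> C}"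
        have RQ: "Inl (w, j) \<in> Q" if "w \<in> R" "j < f w" for w j using that QInl by (auto simp: R_def)
        have RQ': "Inr (w, x) \<in> Q" if "w \<in> R" "(w, x) \<in> E" for w x using that QInr by (auto simp: R_def)
        have arcC: "Inl (w, j) \<in> C" if "Inr (w, x) \<in> C" "w \<in> R" "j < f w" for w x j
          using step[OF C that(1) RQ[OF that(2,3)]] by simp
        have Yarc: "Inr (w, x) \<in> C" if "w \<in> Y" "(w, x) \<in> E" for w x
        proof -
          have w: "w \<in> R" "Inl (w, 0) \<in> C" using that f0 by (auto simp: Y_def R_def)
          show ?thesis using step[OF C w(2) RQ'[OF w(1) that(2)]] by simp
        qed
        have "K \<subseteq> Y" unfolding K_def
        proof (rule gcomp_least)
          obtain w where w: "(v, w) \<in> E" using noiso[of v] v(1) by (auto simp: R_def)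
          have "Inr (v, w) \<in> C" using step[OF C r(1) RQ'[OF v(1) w]] by simp
          then show "v \<in> Y" using arcC v(1) by (auto simp: Y_def)
          fix a b assume ab: "a \<in> Y" "b \<in> R" "(a, b) \<in> E"
          have "Inr (b, a) \<in> C"
            using step[OF C Yarc[OF ab(1,3)] RQ'[OF ab(2) symD[OF sym ab(3)]]] by simp
          then show "b \<in> Y" using arcC ab(2) by (auto simp: Y_def)
        qed
        moreover have "Inr (s, w) \<in> C" if "s \<in> S" "w \<in> K" "(s, w) \<in> E" for s w
        proof -
          have "Inr (w, s) \<in> C" using Yarc \<open>K \<subseteq> Y\<close> that symD[OF sym] by blast
          moreover have "Inr (s, w) \<in> Q" using that ST QInr by auto
          ultimately show ?thesis using step[OF C] by fastforce
        qed
        ultimately show ?thesis using Yarc by (auto simp: D_def Y_def)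
      qed
      ultimately have "C = D K" by blast
      then show ?thesis using K(1) odd by (auto simp: \<K>_def)
    next
      case s
      have inS: "u \<in> S" if "Inr (u, v) \<in> C" for u v
      proof (rule ccontr)
        assume "u \<notin> S"
        moreover have "u \<in> V" using that CQ QInr EV by blast
        ultimately have "Inl (u, 0) \<in> Q" using QInl f0 by blast
        then show False using step[OF C that] s by fastforce
      qed
      obtain x where "x \<in> C" using comps_nonempty[OF C] by blast
      then obtain u v where uv: "Inr (u, v) \<in> C" using s by (cases x) auto
      have e: "(u, v) \<in> E" "(v, u) \<in> E" using uv CQ QInr symD[OF sym] by blast+
      show ?thesis
      proof (cases "v \<in> T")
        case True
        have "C \<subseteq> {Inr (u, v)}"
          using True inS[OF uv] by (intro least[OF uv]) (auto simp: gadget_adj_Inr_iff QInr QInl)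
        then have "C = {Inr (u, v)}" using uv by blast
        then show ?thesis using True inS[OF uv] e by (auto simp: \<S>_def)
      next
        case False
        then have "Inr (v, u) \<in> Q" using e QInr by blast
        then have vu: "Inr (v, u) \<in> C" using step[OF C uv] by simp
        \<comment> \<open>An edge within \<open>S\<close> leaves just its two ends, an even
          component.\<close>
        have "C \<subseteq> {Inr (u, v), Inr (v, u)}"
          using inS[OF uv] inS[OF vu] by (intro least[OF uv]) (auto simp: gadget_adj_Inr_iff QInl)
        then have "C = {Inr (u, v), Inr (v, u)}" using uv vu by blast
        moreover have "u \<noteq> v" using e irr by (auto simp: irrefl_def)
        ultimately show ?thesis using odd by auto
      qed
    qed
  qed
  then have sub: "odd_comps ?G Q \<subseteq> \<T> \<union> \<S> \<union> D ` \<K>" by blast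
  have finK: "finite \<K>" using finite_comps[of R E] fin by (auto simp: \<K>_def R_def)
  have finT': "finite \<T>" unfolding \<T>_def using finST by (intro finite_imageI finite_SigmaI) auto
  have finS': "finite \<S>" unfolding \<S>_def using finE by auto
  have "oddc ?G Q \<le> card (\<T> \<union> \<S> \<union> D ` \<K>)"
    using sub finK finT' finS' by (intro card_mono) auto
  also have "\<dots> \<le> card \<T> + card \<S> + card (D ` \<K>)"
    by (meson add_le_mono1 card_Un_le order_trans)
  also have "card (D ` \<K>) \<le> card \<K>" using finK by (rule card_image_le)
  also have "card \<S> \<le> card (E \<inter> S \<times> T)" unfolding \<S>_def using finE by (intro card_image_le) auto
  also have "card \<T> \<le> (\<Sum>v\<in>T. if v \<in> L then f v - 2 else f v)"
  proof -
    have "card \<T> \<le> card (SIGMA v:T. {i. i < f v \<and> (v \<in> L \<longrightarrow> i \<ge> 2)})"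
      unfolding \<T>_def using finST by (intro card_image_le finite_SigmaI) auto
    also have "\<dots> = (\<Sum>v\<in>T. card {i. i < f v \<and> (v \<in> L \<longrightarrow> i \<ge> 2)})"
      using finST by (intro card_SigmaI) auto
    also have "\<dots> = (\<Sum>v\<in>T. if v \<in> L then f v - 2 else f v)"
    proof (rule sum.cong[OF refl])
      fix v
      have "{i. i < f v \<and> 2 \<le> i} = {2..<f v}" by auto
      then show "card {i. i < f v \<and> (v \<in> L \<longrightarrow> i \<ge> 2)} = (if v \<in> L then f v - 2 else f v)"
        by simp
    qed
    finally show ?thesis .
  qed
  finally have ub: "oddc ?G Q \<le> (\<Sum>v\<in>T. if v \<in> L then f v - 2 else f v) + card (E \<inter> S \<times> T) + card \<K>"
    by simp
  \<comment> \<open>The gadget has even order, so the number of odd components has the parity of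
    \<open>card W\<close>, and an excess of one is automatically an excess of two.\<close>
  have "card ?N = (\<Sum>v\<in>V. f v) + card E"
    unfolding gadget_nodes_def using fin finE by (intro card_copies) auto
  then have "even (card ?N)" using even card_sym_irrefl[OF finE sym irr] by simp
  moreover have "card ?N = card Q + card W"
    using card_Diff_subset[OF finite_subset[OF W(1) finN] W(1)] card_mono[OF finN W(1)]
    by (simp add: Q_def)
  ultimately have "even (oddc ?G Q) \<longleftrightarrow> even (card W)"
    using even_card_iff_oddc[OF sym_gadget_edges, of Q] finN by (simp add: Q_def)
  then have "oddc ?G Q \<noteq> Suc (card W)" by auto
  then have lb: "oddc ?G Q \<ge> card W + 2" using W(2) by (simp add: Q_def)
  have "\<K> = {K \<in> comps E R. odd ((\<Sum>v\<in>K. f v) + card (E \<inter> K \<times> V) + card (E \<inter> S \<times> K))}"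
    using cD comps_subset unfolding \<K>_def by (metis (no_types, lifting))
  then show thesis using that[OF SV TV ST] ub lb cW by (simp add: R_def)
qed

section \<open>Symmetric matrices\<close>

text \<open>Take a complex eigenvector x + iy. Symmetry equates the pairing of \<open>y\<close> with
  Ax and that of \<open>x\<close> with Ay, which forces the eigenvalue to be real. Then
  \<open>x\<close> and \<open>y\<close> each satisfy the eigenvector equation, and one of them is
  nonzero.\<close>

lemma real_symmetric_eigenvector:
  fixes A :: "real mat"
  assumes A: "A \<in> carrier_mat n n" and sym: "A\<^sup>T = A" and n: "n > 0"
  shows "\<exists>v e. eigenvector A v e"
proof -
  let ?B = "map_mat complex_of_real A"
  have B: "?B \<in> carrier_mat n n" using A by simp
  obtain z w where w: "eigenvector ?B w z"
    using spectrum_non_empty[OF B n] by (auto simp: spectrum_def eigenvalue_def)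
  have wn: "w \<in> carrier_vec n" "w \<noteq> 0\<^sub>v n" "?B *\<^sub>v w = z \<cdot>\<^sub>v w"
    using w A by (auto simp: eigenvector_def)
  define x where "x k = Re (w $ k)" for k
  define y where "y k = Im (w $ k)" for k
  have Bw: "(\<Sum>k<n. complex_of_real (A $$ (i, k)) * w $ k) = z * w $ i" if "i < n" for i
  proof -
    have "(?B *\<^sub>v w) $ i = (\<Sum>k<n. complex_of_real (A $$ (i, k)) * w $ k)"
      using A wn(1) that by (auto simp: scalar_prod_def lessThan_atLeast0 intro!: sum.cong)
    then show ?thesis using wn(1,3) that by simp
  qed
  have Ax: "(\<Sum>k<n. A $$ (i, k) * x k) = Re z * x i - Im z * y i" if "i < n" for i
    using arg_cong[OF Bw[OF that], of Re] by (simp add: x_def y_def)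
  have Ay: "(\<Sum>k<n. A $$ (i, k) * y k) = Re z * y i + Im z * x i" if "i < n" for i
    using arg_cong[OF Bw[OF that], of Im] by (simp add: x_def y_def)
  have symA: "A $$ (i, k) = A $$ (k, i)" if "i < n" "k < n" for i k
    using arg_cong[OF sym, of "\<lambda>M. M $$ (i, k)"] A that by simp
  have "(\<Sum>i<n. y i * (\<Sum>k<n. A $$ (i, k) * x k)) = (\<Sum>i<n. \<Sum>k<n. x k * (A $$ (k, i) * y i))"
    by (auto simp: sum_distrib_left symA intro!: sum.cong)
  also have "\<dots> = (\<Sum>k<n. x k * (\<Sum>i<n. A $$ (k, i) * y i))"
    by (subst sum.swap) (simp add: sum_distrib_left)
  finally have "(\<Sum>i<n. y i * (Re z * x i - Im z * y i)) = (\<Sum>k<n. x k * (Re z * y k + Im z * x k))"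
    using Ax Ay by simp
  then have "0 = (\<Sum>k<n. x k * (Re z * y k + Im z * x k) - y k * (Re z * x k - Im z * y k))"
    by (simp add: sum_subtractf)
  also have "\<dots> = Im z * (\<Sum>k<n. x k * x k + y k * y k)"
    by (simp add: algebra_simps sum_distrib_left)
  finally have im: "Im z * (\<Sum>k<n. x k * x k + y k * y k) = 0" by simp
  obtain k0 where k0: "k0 < n" "w $ k0 \<noteq> 0"
    using wn(1,2) by (metis carrier_vecD eq_vecI index_zero_vec)
  have "x k0 * x k0 + y k0 * y k0 \<noteq> 0"
    using k0(2) by (simp add: x_def y_def sum_squares_eq_zero_iff complex_eq_iff)
  then have "(\<Sum>k<n. x k * x k + y k * y k) \<noteq> 0"
    using k0(1) by (subst sum_nonneg_eq_0_iff) auto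
  then have z: "Im z = 0" using im by simp
  have ev: "eigenvector A (vec n u) (Re z)"
    if "\<And>i. i < n \<Longrightarrow> (\<Sum>k<n. A $$ (i, k) * u k) = Re z * u i" "u k0 \<noteq> 0" for u
  proof -
    have "A *\<^sub>v vec n u = Re z \<cdot>\<^sub>v vec n u"
      using A that(1) by (intro eq_vecI) (auto simp: scalar_prod_def lessThan_atLeast0)
    moreover have "vec n u \<noteq> 0\<^sub>v n" using that(2) k0(1) by (metis index_vec index_zero_vec(1))
    ultimately show ?thesis using A by (auto simp: eigenvector_def)
  qed
  have "x k0 \<noteq> 0 \<or> y k0 \<noteq> 0" using k0(2) by (simp add: x_def y_def complex_eq_iff)
  then show ?thesis using ev[of x] ev[of y] Ax Ay z by auto
qed

text \<open>A Householder reflection.\<close>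

lemma orthogonal_mat_with_first_col:
  fixes v :: "real vec"
  assumes v: "v \<in> carrier_vec n" "v \<bullet> v = 1" and n: "n > 0"
  shows "\<exists>W \<in> carrier_mat n n. W\<^sup>T * W = 1\<^sub>m n \<and> col W 0 = v"
proof -
  define d where "d i j = (if i = j then 1 else 0 :: real)" for i j :: nat
  define u where "u k = v $ k - d k 0" for k
  define s where "s = (\<Sum>k<n. u k * u k)"
  \<comment> \<open>If \<open>v\<close> is already the first unit vector, then \<open>s = 0\<close>,
    the convention for division by zero gives \<open>c = 0\<close>, and \<open>W\<close> is the
    identity. Otherwise \<open>W\<close> reflects along \<open>u\<close> and exchanges
    \<open>v\<close> with the first unit vector.\<close>
  define c where "c = 2 / s"
  define W where "W = mat n n (\<lambda>(i, j). d i j - c * u i * u j)"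
  have vv: "(\<Sum>k<n. v $ k * v $ k) = 1"
    using v by (simp add: scalar_prod_def lessThan_atLeast0)
  have "s = (\<Sum>k<n. v $ k * v $ k - 2 * (d k 0 * v $ k) + d k 0)"
    unfolding s_def by (rule sum.cong) (auto simp: u_def d_def algebra_simps)
  also have "\<dots> = 1 - 2 * (\<Sum>k<n. d k 0 * v $ k) + (\<Sum>k<n. d k 0)"
    by (simp add: sum.distrib sum_subtractf vv sum_distrib_left)
  also have "(\<Sum>k<n. d k 0 * v $ k) = v $ 0"
    using n by (simp add: d_def if_distrib[of "\<lambda>x. x * _"] sum.delta cong: if_cong)
  also have "(\<Sum>k<n. d k 0) = 1" using n by (simp add: d_def sum.delta)
  finally have s: "s = 2 * (1 - v $ 0)" by simp
  have u0: "u 0 = - s / 2" by (simp add: u_def d_def s)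
  have uz: "u k = 0" if "s = 0" "k < n" for k
  proof -
    have "\<forall>k\<in>{..<n}. u k * u k = 0"
      using that(1) unfolding s_def by (subst (asm) sum_nonneg_eq_0_iff) auto
    then show ?thesis using that(2) by simp
  qed
  have "W\<^sup>T = W" by (rule eq_matI) (auto simp: W_def d_def)
  have "W * W = 1\<^sub>m n"
  proof (rule eq_matI)
    fix i j assume ij: "i < dim_row (1\<^sub>m n :: real mat)" "j < dim_col (1\<^sub>m n :: real mat)"
    then have ij: "i < n" "j < n" by auto
    have "(W * W) $$ (i, j) = (\<Sum>k<n. (d i k - c * u i * u k) * (d k j - c * u k * u j))"
      using ij by (simp add: W_def scalar_prod_def lessThan_atLeast0)
    also have "\<dots> = (\<Sum>k<n. d i k * d k j - c * u j * (d i k * u k) - c * u i * (d k j * u k)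
        + c * c * u i * u j * (u k * u k))"
      by (rule sum.cong) (auto simp: algebra_simps)
    also have "\<dots> = (\<Sum>k<n. d i k * d k j) - c * u j * (\<Sum>k<n. d i k * u k)
        - c * u i * (\<Sum>k<n. d k j * u k) + c * c * u i * u j * s"
      by (simp add: sum.distrib sum_subtractf sum_distrib_left s_def)
    also have "(\<Sum>k<n. d i k * d k j) = d i j"
      using ij by (simp add: d_def if_distrib[of "\<lambda>x. x * _"] sum.delta cong: if_cong)
    also have "(\<Sum>k<n. d i k * u k) = u i"
      using ij by (simp add: d_def if_distrib[of "\<lambda>x. x * _"] sum.delta cong: if_cong)
    also have "(\<Sum>k<n. d k j * u k) = u j"
      using ij by (simp add: d_def if_distrib[of "\<lambda>x. x * _"] sum.delta cong: if_cong)
    also have "d i j - c * u j * u i - c * u i * u j + c * c * u i * u j * s = d i j"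
      by (cases "s = 0") (simp_all add: c_def field_simps)
    finally show "(W * W) $$ (i, j) = 1\<^sub>m n $$ (i, j)" using ij by (simp add: d_def)
  qed (auto simp: W_def)
  moreover have "col W 0 = v"
  proof (rule eq_vecI)
    fix i assume "i < dim_vec v"
    then have i: "i < n" using v(1) by simp
    have "col W 0 $ i = d i 0 - c * u 0 * u i" using i n by (simp add: W_def)
    also have "\<dots> = d i 0 + u i"
      using uz[OF _ i] by (cases "s = 0") (simp_all add: c_def u0)
    finally show "col W 0 $ i = v $ i" by (simp add: u_def)
  qed (use v in \<open>auto simp: W_def\<close>)
  ultimately show ?thesis using \<open>W\<^sup>T = W\<close> by (intro bexI[of _ W]) (auto simp: W_def)
qed

text \<open>Deflation: conjugating by an orthogonal matrix whose first column is a unit eigenvector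
  clears the rest of the first column, by symmetry also of the first row, and leaves a smaller
  symmetric block for the induction.\<close>

theorem real_symmetric_diagonalization:
  fixes A :: "real mat"
  assumes "A \<in> carrier_mat n n" "A\<^sup>T = A"
  shows "\<exists>P f. P \<in> carrier_mat n n \<and> P\<^sup>T * P = 1\<^sub>m n \<and> A = P * mat_diag n f * P\<^sup>T"
  using assms
proof (induction n arbitrary: A)
  case 0
  then show ?case by (intro exI[of _ "1\<^sub>m 0"] exI) (auto intro!: eq_matI)
next
  case (Suc n A)
  note A = Suc.prems(1)
  let ?N = "Suc n"
  obtain v e where ev: "eigenvector A v e"
    using real_symmetric_eigenvector[OF Suc.prems] by auto
  then have v: "v \<in> carrier_vec ?N" "v \<noteq> 0\<^sub>v ?N" "A *\<^sub>v v = e \<cdot>\<^sub>v v"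
    using A by (auto simp: eigenvector_def)
  define s where "s = v \<bullet> v"
  have s: "s > 0"
  proof -
    obtain k where k: "k < ?N" "v $ k \<noteq> 0"
      using v(1,2) by (metis carrier_vecD eq_vecI index_zero_vec)
    have "(\<Sum>i<?N. v $ i * v $ i) > 0"
      using k by (intro sum_pos2[of _ k]) (auto simp: zero_less_mult_iff)
    then show ?thesis using v(1) by (simp only: s_def scalar_prod_def lessThan_atLeast0 carrier_vecD)
  qed
  define x where "x = (1 / sqrt s) \<cdot>\<^sub>v v"
  have x: "x \<in> carrier_vec ?N" using v(1) by (simp add: x_def)
  have "x \<bullet> x = 1" using v(1) s by (simp add: x_def s_def[symmetric])
  then obtain W where W: "W \<in> carrier_mat ?N ?N" "W\<^sup>T * W = 1\<^sub>m ?N" "col W 0 = x"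
    using orthogonal_mat_with_first_col[OF x] by auto
  have WT: "W\<^sup>T \<in> carrier_mat ?N ?N" using W(1) by simp
  have WW: "W * W\<^sup>T = 1\<^sub>m ?N" using mat_mult_left_right_inverse[OF WT W(1,2)] .
  have Ax: "A *\<^sub>v x = e \<cdot>\<^sub>v x"
    using mult_mat_vec[OF A v(1)] v(3) by (simp add: x_def smult_smult_assoc mult.commute)
  define B where "B = W\<^sup>T * A * W"
  have B: "B \<in> carrier_mat ?N ?N" using W(1) A by (simp add: B_def)
  have AB: "A = W * B * W\<^sup>T"
  proof -
    have "W * B * W\<^sup>T = (W * W\<^sup>T) * A * (W * W\<^sup>T)"
      using W(1) A by (simp add: B_def assoc_mult_mat[of _ ?N ?N _ ?N _ ?N])
    then show ?thesis using A WW by simp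
  qed
  have symB: "B\<^sup>T = B"
    using W(1) A Suc.prems(2)
    by (simp add: B_def transpose_mult[of _ ?N ?N _ ?N] assoc_mult_mat[of _ ?N ?N _ ?N _ ?N])
  have B0: "B $$ (i, 0) = (if i = 0 then e else 0)" if i: "i < ?N" for i
  proof -
    have "col B 0 = (W\<^sup>T * A) *\<^sub>v col W 0"
      unfolding B_def using W(1) A by (intro col_mult2[of _ ?N ?N _ ?N]) auto
    also have "\<dots> = W\<^sup>T *\<^sub>v (e \<cdot>\<^sub>v x)"
      using W A x Ax by (simp add: assoc_mult_mat_vec[of _ ?N ?N _ ?N])
    also have "\<dots> = e \<cdot>\<^sub>v (W\<^sup>T *\<^sub>v col W 0)"
      using W x WT by (simp add: mult_mat_vec[of _ ?N ?N])
    also have "W\<^sup>T *\<^sub>v col W 0 = col (W\<^sup>T * W) 0"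
      using W(1) WT by (intro col_mult2[symmetric, of _ ?N ?N _ ?N]) auto
    finally have "col B 0 = e \<cdot>\<^sub>v col (1\<^sub>m ?N) 0" using W(2) by simp
    then have "col B 0 $ i = (e \<cdot>\<^sub>v col (1\<^sub>m ?N) 0) $ i" by simp
    then show ?thesis using B i by auto
  qed
  have B0': "B $$ (0, i) = (if i = 0 then e else 0)" if i: "i < ?N" for i
    using B0[OF i] arg_cong[OF symB, of "\<lambda>M. M $$ (i, 0)"] B i by simp
  define A3 where "A3 = mat n n (\<lambda>(i, j). B $$ (Suc i, Suc j))"
  have A3: "A3 \<in> carrier_mat n n" by (simp add: A3_def)
  have "B $$ (Suc j, Suc i) = B $$ (Suc i, Suc j)" if "i < n" "j < n" for i j
    using arg_cong[OF symB, of "\<lambda>M. M $$ (Suc i, Suc j)"] B that by simp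
  then have "A3\<^sup>T = A3" by (intro eq_matI) (auto simp: A3_def)
  then obtain P f where P: "P \<in> carrier_mat n n" "P\<^sup>T * P = 1\<^sub>m n" "A3 = P * mat_diag n f * P\<^sup>T"
    using Suc.IH[OF A3] by blast
  let ?e = "mat 1 1 (\<lambda>_. e)"
  let ?z = "0\<^sub>m 1 n" and ?z' = "0\<^sub>m n 1"
  have Bblock: "B = four_block_mat ?e ?z ?z' A3"
    using B B0 B0' by (intro eq_matI) (auto simp: A3_def)
  define U where "U = four_block_mat (1\<^sub>m 1) ?z ?z' P"
  define D where "D = mat_diag ?N (case_nat e f)"
  have U: "U \<in> carrier_mat ?N ?N" using P(1) unfolding U_def by (metis four_block_carrier_mat one_carrier_mat plus_1_eq_Suc)
  have UT: "U\<^sup>T = four_block_mat (1\<^sub>m 1) ?z ?z' (P\<^sup>T)"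
    unfolding U_def using P(1) by (subst transpose_four_block_mat) auto
  have PT: "P\<^sup>T \<in> carrier_mat n n" using P(1) by simp
  have Dblock: "D = four_block_mat ?e ?z ?z' (mat_diag n f)"
    unfolding D_def by (rule eq_matI) (auto simp: mat_diag_def split: nat.splits)
  have D: "D \<in> carrier_mat ?N ?N" by (simp add: D_def)
  have UU: "U\<^sup>T * U = 1\<^sub>m ?N"
  proof -
    have "U\<^sup>T * U = four_block_mat (1\<^sub>m 1 * 1\<^sub>m 1 + ?z * ?z') (1\<^sub>m 1 * ?z + ?z * P)
        (?z' * 1\<^sub>m 1 + P\<^sup>T * ?z') (?z' * ?z + P\<^sup>T * P)"
      unfolding UT unfolding U_def using P(1) PT by (intro mult_four_block_mat) auto
    also have "\<dots> = four_block_mat (1\<^sub>m 1) ?z ?z' (1\<^sub>m n)" using P PT by simp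
    finally show ?thesis by simp
  qed
  have UD: "U * D = four_block_mat ?e ?z ?z' (P * mat_diag n f)"
  proof -
    have "U * D = four_block_mat (1\<^sub>m 1 * ?e + ?z * ?z') (1\<^sub>m 1 * ?z + ?z * mat_diag n f)
        (?z' * ?e + P * ?z') (?z' * ?z + P * mat_diag n f)"
      unfolding Dblock U_def using P(1) by (intro mult_four_block_mat) auto
    also have "\<dots> = four_block_mat ?e ?z ?z' (P * mat_diag n f)"
      using P(1) by (simp add: left_mult_zero_mat[OF mat_diag_dim])
    finally show ?thesis .
  qed
  have UDU: "U * D * U\<^sup>T = B"
  proof -
    have PD: "P * mat_diag n f \<in> carrier_mat n n" using P(1) by auto
    have "U * D * U\<^sup>T = four_block_mat (?e * 1\<^sub>m 1 + ?z * ?z') (?e * ?z + ?z * P\<^sup>T)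
        (?z' * 1\<^sub>m 1 + P * mat_diag n f * ?z') (?z' * ?z + P * mat_diag n f * P\<^sup>T)"
      unfolding UD UT using PD PT by (intro mult_four_block_mat) auto
    also have "\<dots> = four_block_mat ?e ?z ?z' A3"
      using A3 by (simp add: P(3)[symmetric] right_mult_zero_mat[OF PD] left_mult_zero_mat[OF PT])
    finally show ?thesis using Bblock by simp
  qed
  have UT': "U\<^sup>T \<in> carrier_mat ?N ?N" using U by simp
  have T: "(W * U)\<^sup>T = U\<^sup>T * W\<^sup>T" using W(1) U by (rule transpose_mult)
  have "(W * U)\<^sup>T * (W * U) = U\<^sup>T * (W\<^sup>T * W) * U"
    unfolding T using W(1) U WT UT' by (simp add: assoc_mult_mat[of _ ?N ?N _ ?N _ ?N])
  then have 1: "(W * U)\<^sup>T * (W * U) = 1\<^sub>m ?N" using W(2) UU UT' by simp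
  have "(W * U) * D * (W * U)\<^sup>T = W * (U * D * U\<^sup>T) * W\<^sup>T"
    unfolding T using W(1) U WT UT' D by (simp add: assoc_mult_mat[of _ ?N ?N _ ?N _ ?N])
  then have 2: "A = (W * U) * D * (W * U)\<^sup>T" using UDU AB by simp
  show ?case using 1 2 W(1) U unfolding D_def by (intro exI[of _ "W * U"] exI[of _ "case_nat e f"]) auto
qed

section \<open>The Courant--Fischer bound\<close>

text \<open>The dimension count behind the bound: it supplies a combination of \<open>j\<close> test
  vectors orthogonal to fewer than \<open>j\<close> eigenvectors. Each induction step eliminates one
  unknown \<open>l0\<close> with the help of one equation.\<close>

lemma homogeneous_system:
  fixes b :: "'a \<Rightarrow> 'b \<Rightarrow> real"
  assumes "finite I" "finite J" "card I < card J"
  shows "\<exists>c. (\<exists>l\<in>J. c l \<noteq> 0) \<and> (\<forall>i\<in>I. (\<Sum>l\<in>J. b i l * c l) = 0)"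
  using assms
proof (induction I arbitrary: J b rule: finite_induct)
  case empty
  then have "J \<noteq> {}" by auto
  then show ?case by (intro exI[of _ "\<lambda>_. 1"]) auto
next
  case (insert i I)
  show ?case
  proof (cases "\<forall>l\<in>J. b i l = 0")
    case True
    moreover have "card I < card J" using insert by simp
    then obtain c where "\<exists>l\<in>J. c l \<noteq> 0" "\<forall>i\<in>I. (\<Sum>l\<in>J. b i l * c l) = 0"
      using insert.IH[OF insert.prems(1), of b] by blast
    ultimately show ?thesis by (intro exI[of _ c]) auto
  next
    case False
    then obtain l0 where l0: "l0 \<in> J" "b i l0 \<noteq> 0" by blast
    let ?J = "J - {l0}"
    have "card I < card ?J" using insert l0 by simp
    then obtain c where c: "\<exists>l\<in>?J. c l \<noteq> 0"
      "\<forall>i'\<in>I. (\<Sum>l\<in>?J. (b i' l - b i' l0 * b i l / b i l0) * c l) = 0"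
      using insert.IH[of ?J "\<lambda>i' l. b i' l - b i' l0 * b i l / b i l0"] insert.prems(1) by blast
    define t where "t = - (\<Sum>l\<in>?J. b i l * c l) / b i l0"
    define c' where "c' = c(l0 := t)"
    have split: "(\<Sum>l\<in>J. b i' l * c' l) = b i' l0 * t + (\<Sum>l\<in>?J. b i' l * c l)" for i'
    proof -
      have "(\<Sum>l\<in>?J. b i' l * c' l) = (\<Sum>l\<in>?J. b i' l * c l)"
        by (intro sum.cong) (auto simp: c'_def)
      then show ?thesis
        using sum.remove[OF insert.prems(1) l0(1), of "\<lambda>l. b i' l * c' l"] by (simp add: c'_def)
    qed
    have "(\<Sum>l\<in>J. b i' l * c' l) = 0" if "i' \<in> I" for i'
    proof -
      have "0 = (\<Sum>l\<in>?J. b i' l * c l - b i' l0 / b i l0 * (b i l * c l))"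
        using c(2) that by (auto simp: algebra_simps)
      also have "\<dots> = (\<Sum>l\<in>?J. b i' l * c l) - b i' l0 / b i l0 * (\<Sum>l\<in>?J. b i l * c l)"
        by (simp only: sum_subtractf sum_distrib_left)
      finally show ?thesis by (simp add: split t_def)
    qed
    moreover have "(\<Sum>l\<in>J. b i l * c' l) = 0" using l0 by (simp add: split t_def)
    moreover have "\<exists>l\<in>J. c' l \<noteq> 0" using c(1) by (auto simp: c'_def)
    ultimately show ?thesis by (intro exI[of _ c']) auto
  qed
qed

text \<open>The matrix is a parameter so that the same facts serve for the adjacency form and, with
  the identity matrix, for the inner product.\<close>

definition bilin :: "nat \<Rightarrow> (nat \<Rightarrow> nat \<Rightarrow> real) \<Rightarrow> (nat \<Rightarrow> real) \<Rightarrow> (nat \<Rightarrow> real) \<Rightarrow> real" where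
  "bilin n M x y = (\<Sum>k<n. \<Sum>k'<n. x k * M k k' * y k')"

lemma bilin_sum_left:
  "bilin n M (\<lambda>k. \<Sum>l\<in>J. c l * X l k) y = (\<Sum>l\<in>J. c l * bilin n M (X l) y)"
proof -
  have "bilin n M x y = (\<Sum>k<n. x k * (\<Sum>k'<n. M k k' * y k'))" for x
    by (simp add: bilin_def sum_distrib_left mult.assoc)
  then show ?thesis
    by (simp add: sum_distrib_right sum_distrib_left mult.assoc sum.swap[of _ J])
qed

lemma bilin_sum_right:
  "bilin n M x (\<lambda>k. \<Sum>l\<in>J. c l * X l k) = (\<Sum>l\<in>J. c l * bilin n M x (X l))"
proof -
  have "bilin n M x y = bilin n (\<lambda>k k'. M k' k) y x" for x y
    unfolding bilin_def by (subst sum.swap) (simp add: mult_ac)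
  then show ?thesis by (simp add: bilin_sum_left)
qed

lemma bilin_diagonal:
  assumes M: "\<And>k k'. k < n \<Longrightarrow> k' < n \<Longrightarrow> M k k' = (\<Sum>i<n. p k i * g i * p k' i)"
  shows "bilin n M x x = (\<Sum>i<n. g i * (\<Sum>k<n. p k i * x k)\<^sup>2)"
proof -
  have "bilin n M x x = (\<Sum>k<n. \<Sum>k'<n. \<Sum>i<n. x k * (p k i * g i * p k' i) * x k')"
    by (simp add: bilin_def M sum_distrib_left sum_distrib_right)
  also have "\<dots> = (\<Sum>i<n. \<Sum>k<n. \<Sum>k'<n. g i * (p k i * x k) * (p k' i * x k'))"
    by (subst (2) sum.swap, subst sum.swap) (simp add: mult_ac)
  also have "\<dots> = (\<Sum>i<n. g i * (\<Sum>k<n. p k i * x k)\<^sup>2)"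
    unfolding power2_eq_square sum_product by (simp only: sum_distrib_left mult.assoc)
  finally show ?thesis .
qed

text \<open>Some nonzero combination of the test vectors is orthogonal to the eigenvectors with index
  in \<open>I\<close>.\<close>

lemma courant_fischer_lower:
  fixes X :: "nat \<Rightarrow> nat \<Rightarrow> real"
  assumes P: "P \<in> carrier_mat n n" "P\<^sup>T * P = 1\<^sub>m n" and A: "A = P * mat_diag n f * P\<^sup>T"
    and I: "I \<subseteq> {..<n}" "card I < j"
    and pos: "\<And>l. l < j \<Longrightarrow> (\<Sum>k<n. (X l k)\<^sup>2) > 0"
    and orth: "\<And>l m. l < j \<Longrightarrow> m < j \<Longrightarrow> l \<noteq> m \<Longrightarrow> (\<Sum>k<n. X l k * X m k) = 0"
    and orthA: "\<And>l m. l < j \<Longrightarrow> m < j \<Longrightarrow> l \<noteq> m \<Longrightarrow> bilin n (\<lambda>k k'. A $$ (k, k')) (X l) (X m) = 0"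
    and ge: "\<And>l. l < j \<Longrightarrow> bilin n (\<lambda>k k'. A $$ (k, k')) (X l) (X l) \<ge> \<rho> * (\<Sum>k<n. (X l k)\<^sup>2)"
  shows "\<exists>i<n. i \<notin> I \<and> \<rho> \<le> f i"
proof (rule ccontr)
  assume neg: "\<not> ?thesis"
  define p where "p k i = P $$ (k, i)" for k i
  let ?A = "\<lambda>k k'. A $$ (k, k')" and ?D = "\<lambda>k k'. if k = k' then 1 else 0 :: real"
  have PT: "P\<^sup>T \<in> carrier_mat n n" using P(1) by simp
  have PP: "P * P\<^sup>T = 1\<^sub>m n" using mat_mult_left_right_inverse[OF PT P] .
  have eA: "?A k k' = (\<Sum>i<n. p k i * f i * p k' i)" if "k < n" "k' < n" for k k'
  proof -
    have "A = mat n n (\<lambda>(i, j). P $$ (i, j) * f j) * P\<^sup>T" using A P(1) by (simp add: mat_diag_mult_right)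
    then show ?thesis using that P(1)
      by (simp add: scalar_prod_def p_def lessThan_atLeast0)
  qed
  \<comment> \<open>Orthogonality of the rows of \<open>P\<close> writes the identity matrix in the
    shape of \<open>eA\<close> with all eigenvalues 1, so \<open>bilin_diagonal\<close> yields
    Parseval's identity as well.\<close>
  have eD: "?D k k' = (\<Sum>i<n. p k i * 1 * p k' i)" if "k < n" "k' < n" for k k'
    using arg_cong[OF PP, of "\<lambda>M. M $$ (k, k')"] that P(1)
    by (simp add: scalar_prod_def p_def lessThan_atLeast0)
  have bD: "bilin n ?D x y = (\<Sum>k<n. x k * y k)" for x y
    by (simp add: bilin_def if_distrib[of "\<lambda>t. _ * t"] if_distrib[of "\<lambda>t. t * _"] sum.delta cong: if_cong)
  have finI: "finite I" using I(1) finite_subset by blast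
  obtain c where c: "\<exists>l\<in>{..<j}. c l \<noteq> 0"
    "\<forall>i\<in>I. (\<Sum>l<j. (\<Sum>k<n. p k i * X l k) * c l) = 0"
    using homogeneous_system[OF finI, of "{..<j}" "\<lambda>i l. \<Sum>k<n. p k i * X l k"] I(2) by auto
  define y where "y k = (\<Sum>l<j. c l * X l k)" for k
  define z where "z i = (\<Sum>k<n. p k i * y k)" for i
  have diag: "bilin n M y y = (\<Sum>l<j. (c l)\<^sup>2 * bilin n M (X l) (X l))"
    if "\<And>l m. l < j \<Longrightarrow> m < j \<Longrightarrow> l \<noteq> m \<Longrightarrow> bilin n M (X l) (X m) = 0" for M
  proof -
    have "bilin n M y y = (\<Sum>l<j. c l * (\<Sum>m<j. c m * bilin n M (X l) (X m)))"
      unfolding y_def by (simp only: bilin_sum_left bilin_sum_right)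
    also have "\<dots> = (\<Sum>l<j. c l * (c l * bilin n M (X l) (X l)))"
    proof (intro sum.cong refl arg_cong[of _ _ "(*) _"])
      fix l assume l: "l \<in> {..<j}"
      have "(\<Sum>m<j. c m * bilin n M (X l) (X m)) = (\<Sum>m<j. if m = l then c l * bilin n M (X l) (X l) else 0)"
        using l that by (intro sum.cong) auto
      then show "(\<Sum>m<j. c m * bilin n M (X l) (X m)) = c l * bilin n M (X l) (X l)"
        using l by simp
    qed
    finally show ?thesis by (simp add: power2_eq_square mult.assoc)
  qed
  have zI: "z i = 0" if "i \<in> I" for i
  proof -
    have "z i = (\<Sum>l<j. (\<Sum>k<n. p k i * X l k) * c l)"
      unfolding z_def y_def sum_distrib_left sum_distrib_right
      by (subst sum.swap) (simp add: mult_ac)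
    then show ?thesis using c(2) that by simp
  qed
  have ny: "bilin n ?D y y = (\<Sum>l<j. (c l)\<^sup>2 * (\<Sum>k<n. (X l k)\<^sup>2))"
    using diag[of ?D] orth by (simp add: bD power2_eq_square)
  have Ay: "bilin n ?A y y = (\<Sum>l<j. (c l)\<^sup>2 * bilin n ?A (X l) (X l))"
    using diag[of ?A] orthA by simp
  have nz: "bilin n ?D y y = (\<Sum>i<n. 1 * (z i)\<^sup>2)" unfolding z_def using eD by (rule bilin_diagonal)
  have Az: "bilin n ?A y y = (\<Sum>i<n. f i * (z i)\<^sup>2)" unfolding z_def using eA by (rule bilin_diagonal)
  \<comment> \<open>Since the test vectors are orthogonal for both forms, their bounds add up to one
    for \<open>y\<close>. In the eigenvector coordinates \<open>z\<close>, which vanish on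
    \<open>I\<close>, this is incompatible with \<open>f i < \<rho>\<close> everywhere else.\<close>
  have "\<rho> * bilin n ?D y y = (\<Sum>l<j. (c l)\<^sup>2 * (\<rho> * (\<Sum>k<n. (X l k)\<^sup>2)))"
    unfolding ny by (subst sum_distrib_left) (simp only: mult.left_commute)
  also have "\<dots> \<le> bilin n ?A y y"
    unfolding Ay using ge by (intro sum_mono mult_left_mono) auto
  finally have "\<rho> * bilin n ?D y y \<le> bilin n ?A y y" .
  then have le: "(\<Sum>i<n. (\<rho> - f i) * (z i)\<^sup>2) \<le> 0"
    unfolding nz Az by (simp add: sum_distrib_left sum_subtractf left_diff_distrib)
  have summand: "(\<rho> - f i) * (z i)\<^sup>2 \<ge> 0 \<and> ((\<rho> - f i) * (z i)\<^sup>2 = 0 \<longrightarrow> z i = 0)" if "i < n" for i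
  proof (cases "i \<in> I")
    case False
    then have "\<rho> - f i > 0" using neg that by auto
    then show ?thesis by auto
  qed (simp add: zI)
  then have "(\<Sum>i<n. (\<rho> - f i) * (z i)\<^sup>2) = 0"
    using le by (intro antisym sum_nonneg) auto
  then have "z i = 0" if "i < n" for i
    using that summand by (subst (asm) sum_nonneg_eq_0_iff) auto
  then have "bilin n ?D y y = 0" unfolding nz by simp
  moreover have "bilin n ?D y y > 0"
  proof -
    obtain l where l: "l < j" "c l \<noteq> 0" using c(1) by auto
    show ?thesis unfolding ny
      using l pos by (intro sum_pos2[of _ l]) (auto intro!: mult_nonneg_nonneg sum_nonneg)
  qed
  ultimately show False by simp
qed

section \<open>Eigenvalues of graphs as quadratic forms\<close>

lemma adj_mat_form:
  assumes "distinct vs" "set vs = V" "E \<subseteq> V \<times> V" "finite V" "parcs G = E"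
  shows "bilin (length vs) (\<lambda>k k'. adj_mat G vs $$ (k, k')) (\<lambda>k. x (vs ! k)) (\<lambda>k. y (vs ! k))
    = (\<Sum>(u, v)\<in>E. x u * y v)"
proof -
  let ?n = "length vs"
  have re: "(\<Sum>k<?n. g (vs ! k)) = (\<Sum>v\<in>V. g v)" for g :: "'a \<Rightarrow> real"
    using sum.reindex_bij_betw[OF bij_betw_nth[OF assms(1) refl refl], of g] assms(2) by simp
  have "bilin ?n (\<lambda>k k'. adj_mat G vs $$ (k, k')) (\<lambda>k. x (vs ! k)) (\<lambda>k. y (vs ! k))
    = (\<Sum>k<?n. \<Sum>k'<?n. x (vs ! k) * (if (vs ! k, vs ! k') \<in> E then 1 else 0) * y (vs ! k'))"
    unfolding bilin_def by (intro sum.cong) (auto simp: adj_mat_def assms(5))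
  also have "\<dots> = (\<Sum>k<?n. \<Sum>v\<in>V. x (vs ! k) * (if (vs ! k, v) \<in> E then 1 else 0) * y v)"
    by (intro sum.cong refl re)
  also have "\<dots> = (\<Sum>u\<in>V. \<Sum>v\<in>V. x u * (if (u, v) \<in> E then 1 else 0) * y v)"
    by (rule re)
  also have "\<dots> = (\<Sum>(u, v)\<in>V \<times> V. x u * (if (u, v) \<in> E then 1 else 0) * y v)"
    by (rule sum.cartesian_product)
  also have "\<dots> = (\<Sum>(u, v)\<in>E. x u * y v)"
    using assms(3,4) by (intro sum.mono_neutral_cong_right) auto
  finally show ?thesis .
qed

text \<open>Links the sorted roots of the characteristic polynomial with the spectral theorem: by
  similarity both have the same multiset of values, so the list is the diagonal \<open>f\<close>
  rearranged by some \<open>\<pi>\<close>.\<close>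

lemma adj_spectrum:
  assumes "finite (pverts G)" "sym (parcs G)"
  obtains vs P f \<pi> where "distinct vs" "set vs = pverts G"
    "P \<in> carrier_mat (length vs) (length vs)" "P\<^sup>T * P = 1\<^sub>m (length vs)"
    "adj_mat G vs = P * mat_diag (length vs) f * P\<^sup>T"
    "length (adj_eigenvalues G) = length vs" "sorted (rev (adj_eigenvalues G))"
    "bij_betw \<pi> {..<length vs} {..<length vs}"
    "\<forall>k<length vs. adj_eigenvalues G ! k = f (\<pi> k)"
proof -
  define vs where "vs = (SOME vs. distinct vs \<and> set vs = pverts G)"
  have "\<exists>vs. distinct vs \<and> set vs = pverts G" using finite_distinct_list[OF assms(1)] by blast
  then have vs: "distinct vs" "set vs = pverts G" unfolding vs_def by (metis (mono_tags, lifting) someI_ex)+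
  let ?n = "length vs" and ?A = "adj_mat G vs"
  have A: "?A \<in> carrier_mat ?n ?n" by (simp add: adj_mat_def)
  have "?A\<^sup>T = ?A" using assms(2) by (intro eq_matI) (auto simp: adj_mat_def dest: symD)
  then obtain P f where P: "P \<in> carrier_mat ?n ?n" "P\<^sup>T * P = 1\<^sub>m ?n" "?A = P * mat_diag ?n f * P\<^sup>T"
    using real_symmetric_diagonalization[OF A] by blast
  have PT: "P\<^sup>T \<in> carrier_mat ?n ?n" using P(1) by simp
  have "similar_mat ?A (mat_diag ?n f)"
    using mat_mult_left_right_inverse[OF PT P(1,2)] P(2,3) A P(1) PT
    by (intro similar_matI[of _ _ P "P\<^sup>T" ?n]) auto
  then have "char_poly ?A = char_poly (mat_diag ?n f)" by (rule char_poly_similar)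
  also have "\<dots> = (\<Prod>a\<leftarrow>diag_mat (mat_diag ?n f). [:- a, 1:])"
    by (rule char_poly_upper_triangular[of _ ?n]) (auto simp: mat_diag_def)
  also have "diag_mat (mat_diag ?n f) = map f [0..<?n]"
    by (auto simp: diag_mat_def mat_diag_def)
  finally have cp: "char_poly ?A = (\<Prod>a\<leftarrow>map f [0..<?n]. [:- a, 1:])" .
  have proots: "proots (\<Prod>a\<leftarrow>as. [:- a, 1:]) = mset as" for as :: "real list"
  proof (induction as)
    case (Cons a as)
    have "(\<Prod>a\<leftarrow>as. [:- a, 1:]) \<noteq> (0 :: real poly)" by (auto simp: prod_list_zero_iff)
    then have "proots ([:- a, 1:] * (\<Prod>a\<leftarrow>as. [:- a, 1:])) = proots [:- a, 1:] + mset as"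
      using Cons.IH by (subst proots_mult) auto
    then show ?case by simp
  qed simp
  let ?L = "adj_eigenvalues G"
  have L: "?L = rev (sorted_list_of_multiset (mset (map f [0..<?n])))"
    unfolding adj_eigenvalues_def vs_def[symmetric] cp proots ..
  have m: "mset ?L = mset (map f [0..<?n])" unfolding L by simp
  then have len: "length ?L = ?n" using mset_eq_length[OF m] by simp
  obtain \<pi> where \<pi>: "bij_betw \<pi> {..<length ?L} {..<length (map f [0..<?n])}"
    "\<forall>i<length ?L. ?L ! i = map f [0..<?n] ! \<pi> i"
    using permutation_Ex_bij[of ?L "map f [0..<?n]"] m by auto
  have \<pi>': "bij_betw \<pi> {..<?n} {..<?n}" using \<pi>(1) len by simp
  have "?L ! k = f (\<pi> k)" if "k < ?n" for k
    using \<pi>(2) that len bij_betwE[OF \<pi>'] by simp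
  moreover have "sorted (rev ?L)" unfolding L by simp
  ultimately show thesis using that vs P len \<pi>' by blast
qed

text \<open>Once the eigenvectors belonging to the first \<open>j - 1\<close> list entries are
  excluded, every remaining eigenvalue is at most the \<open>j\<close>-th entry.\<close>

lemma lam_ge:
  fixes X :: "nat \<Rightarrow> 'a \<Rightarrow> real"
  assumes fin: "finite (pverts G)" and sub: "parcs G \<subseteq> pverts G \<times> pverts G"
    and sym: "sym (parcs G)" and j: "1 \<le> j"
    and pos: "\<And>l. l < j \<Longrightarrow> (\<Sum>v\<in>pverts G. (X l v)\<^sup>2) > 0"
    and orth: "\<And>l m. l < j \<Longrightarrow> m < j \<Longrightarrow> l \<noteq> m \<Longrightarrow> (\<Sum>v\<in>pverts G. X l v * X m v) = 0"
    and orthA: "\<And>l m. l < j \<Longrightarrow> m < j \<Longrightarrow> l \<noteq> m \<Longrightarrow> (\<Sum>(u, v)\<in>parcs G. X l u * X m v) = 0"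
    and ge: "\<And>l. l < j \<Longrightarrow> (\<Sum>(u, v)\<in>parcs G. X l u * X l v) \<ge> \<rho> * (\<Sum>v\<in>pverts G. (X l v)\<^sup>2)"
  shows "\<rho> \<le> lam j G"
proof -
  obtain vs P f \<pi> where vs: "distinct vs" "set vs = pverts G"
    and P: "P \<in> carrier_mat (length vs) (length vs)" "P\<^sup>T * P = 1\<^sub>m (length vs)"
      "adj_mat G vs = P * mat_diag (length vs) f * P\<^sup>T"
    and len: "length (adj_eigenvalues G) = length vs" and srt: "sorted (rev (adj_eigenvalues G))"
    and \<pi>: "bij_betw \<pi> {..<length vs} {..<length vs}"
      "\<forall>k<length vs. adj_eigenvalues G ! k = f (\<pi> k)"
    by (rule adj_spectrum[OF fin sym])
  let ?n = "length vs" and ?L = "adj_eigenvalues G"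
  have re: "(\<Sum>k<?n. g (vs ! k)) = (\<Sum>v\<in>pverts G. g v)" for g :: "'a \<Rightarrow> real"
    using sum.reindex_bij_betw[OF bij_betw_nth[OF vs(1) refl refl], of g] vs(2) by simp
  note form = adj_mat_form[OF vs sub fin refl]
  have *: "\<exists>i<?n. i \<notin> I \<and> \<rho> \<le> f i" if "I \<subseteq> {..<?n}" "card I < j" for I
  proof (rule courant_fischer_lower[OF P that])
    show "(\<Sum>k<?n. (X l (vs ! k))\<^sup>2) > 0" if "l < j" for l
      using pos[OF that] re[of "\<lambda>v. (X l v)\<^sup>2"] by simp
    show "(\<Sum>k<?n. X l (vs ! k) * X m (vs ! k)) = 0" if "l < j" "m < j" "l \<noteq> m" for l m
      using orth[OF that] re[of "\<lambda>v. X l v * X m v"] by simp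
    show "bilin ?n (\<lambda>k k'. adj_mat G vs $$ (k, k')) (\<lambda>k. X l (vs ! k)) (\<lambda>k. X m (vs ! k)) = 0"
      if "l < j" "m < j" "l \<noteq> m" for l m
      unfolding form using orthA[OF that] .
    show "\<rho> * (\<Sum>k<?n. (X l (vs ! k))\<^sup>2) \<le>
       bilin ?n (\<lambda>k k'. adj_mat G vs $$ (k, k')) (\<lambda>k. X l (vs ! k)) (\<lambda>k. X l (vs ! k))"
      if "l < j" for l
      unfolding form using ge[OF that] re[of "\<lambda>v. (X l v)\<^sup>2"] by simp
  qed
  \<comment> \<open>\<open>min\<close> keeps the indices in range when the list is short; the index
    found below lies outside \<open>I\<close>, which shows that \<open>j - 1 < ?n\<close> after
    all.\<close>
  define I where "I = \<pi> ` {..<min (j - 1) ?n}"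
  have "I \<subseteq> {..<?n}" using bij_betwE[OF \<pi>(1)] by (auto simp: I_def)
  moreover have "card I < j"
  proof -
    have "card I \<le> min (j - 1) ?n"
      using card_image_le[of "{..<min (j - 1) ?n}" \<pi>] by (simp add: I_def)
    then show ?thesis using j by linarith
  qed
  ultimately obtain i where i: "i < ?n" "i \<notin> I" "\<rho> \<le> f i" using * by blast
  obtain k where k: "k < ?n" "i = \<pi> k" using bij_betw_imp_surj_on[OF \<pi>(1)] i(1) by blast
  then have kj: "j - 1 \<le> k" using i(2) by (auto simp: I_def)
  have "?L ! k \<le> ?L ! (j - 1)"
    using srt kj k(1) len by (simp add: sorted_rev_iff_nth_mono)
  then show ?thesis using i(3) k \<pi>(2) by (simp add: lam_def)
qed

text \<open>The witness is the column of \<open>P\<close> for the first list entry. Only its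
  Rayleigh quotient is recorded, which is what the later estimates use.\<close>

lemma lam_1_eigenfunction:
  assumes fin: "finite (pverts G)" and sub: "parcs G \<subseteq> pverts G \<times> pverts G"
    and sym: "sym (parcs G)" and ne: "pverts G \<noteq> {}"
  obtains x :: "'a \<Rightarrow> real" where "(\<Sum>v\<in>pverts G. (x v)\<^sup>2) > 0"
    "(\<Sum>(u, v)\<in>parcs G. x u * x v) = lam 1 G * (\<Sum>v\<in>pverts G. (x v)\<^sup>2)"
proof -
  obtain vs P f \<pi> where vs: "distinct vs" "set vs = pverts G"
    and P: "P \<in> carrier_mat (length vs) (length vs)" "P\<^sup>T * P = 1\<^sub>m (length vs)"
      "adj_mat G vs = P * mat_diag (length vs) f * P\<^sup>T"
    and len: "length (adj_eigenvalues G) = length vs" and srt: "sorted (rev (adj_eigenvalues G))"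
    and \<pi>: "bij_betw \<pi> {..<length vs} {..<length vs}"
      "\<forall>k<length vs. adj_eigenvalues G ! k = f (\<pi> k)"
    by (rule adj_spectrum[OF fin sym])
  let ?n = "length vs" and ?A = "adj_mat G vs"
  have re: "(\<Sum>k<?n. g (vs ! k)) = (\<Sum>v\<in>pverts G. g v)" for g :: "'a \<Rightarrow> real"
    using sum.reindex_bij_betw[OF bij_betw_nth[OF vs(1) refl refl], of g] vs(2) by simp
  have n: "0 < ?n" using vs ne by auto
  define i where "i = \<pi> 0"
  have i: "i < ?n" using bij_betwE[OF \<pi>(1)] n by (auto simp: i_def)
  have lam: "lam 1 G = f i" using \<pi>(2) n by (simp add: lam_def i_def)
  have inj: "inj_on ((!) vs) {..<?n}" using vs(1) by (simp add: inj_on_nth)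
  define x where "x v = P $$ (inv_into {..<?n} ((!) vs) v, i)" for v
  have x: "x (vs ! k) = P $$ (k, i)" if "k < ?n" for k
    using inj that by (simp add: x_def inv_into_f_f)
  define y where "y m = (\<Sum>k<?n. P $$ (k, m) * x (vs ! k))" for m
  have y: "y m = (if m = i then 1 else 0)" if "m < ?n" for m
    using arg_cong[OF P(2), of "\<lambda>M. M $$ (m, i)"] that P(1) i
    by (simp add: scalar_prod_def y_def x lessThan_atLeast0)
  have eA: "?A $$ (k, k') = (\<Sum>m<?n. P $$ (k, m) * f m * P $$ (k', m))" if "k < ?n" "k' < ?n" for k k'
  proof -
    have "?A = mat ?n ?n (\<lambda>(i, j). P $$ (i, j) * f j) * P\<^sup>T" using P(1,3) by (simp add: mat_diag_mult_right)
    then show ?thesis using that P(1)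
      by (simp add: scalar_prod_def lessThan_atLeast0)
  qed
  have "bilin ?n (\<lambda>k k'. ?A $$ (k, k')) (\<lambda>k. x (vs ! k)) (\<lambda>k. x (vs ! k)) = (\<Sum>m<?n. f m * (y m)\<^sup>2)"
    unfolding y_def using eA by (rule bilin_diagonal)
  also have "\<dots> = (\<Sum>m<?n. if m = i then f i else 0)"
    by (intro sum.cong) (auto simp: y)
  finally have 1: "(\<Sum>(u, v)\<in>parcs G. x u * x v) = f i"
    using i by (simp add: adj_mat_form[OF vs sub fin refl])
  have "(\<Sum>v\<in>pverts G. (x v)\<^sup>2) = (\<Sum>k<?n. P $$ (k, i) * x (vs ! k))"
    unfolding re[symmetric] by (intro sum.cong) (auto simp: x power2_eq_square)
  also have "\<dots> = 1" using y[OF i] by (simp add: y_def)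
  finally show thesis using that[of x] 1 lam by simp
qed

section \<open>The minimum of the largest eigenvalue\<close>

lemma pair_graph_iff:
  "pair_graph G \<longleftrightarrow> finite (pverts G) \<and> parcs G \<subseteq> pverts G \<times> pverts G \<and> sym (parcs G) \<and> irrefl (parcs G)"
proof
  assume "pair_graph G"
  then interpret pair_graph G .
  have "irrefl (parcs G)" using no_loops' by (metis irreflI)
  then show "finite (pverts G) \<and> parcs G \<subseteq> pverts G \<times> pverts G \<and> sym (parcs G) \<and> irrefl (parcs G)"
    using pair_finite_verts in_arcsD1 in_arcsD2 arcs_symmetric by (auto simp: sym_def)
next
  assume *: "finite (pverts G) \<and> parcs G \<subseteq> pverts G \<times> pverts G \<and> sym (parcs G) \<and> irrefl (parcs G)"
  then have "finite (parcs G)" using finite_subset by blast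
  then show "pair_graph G"
    using * by unfold_locales (auto simp: symmetric_def irrefl_def)
qed

lemma vdegree_conv: "vdegree G v = card (parcs G `` {v})"
proof -
  have "bij_betw snd (out_arcs (with_proj G) v) (parcs G `` {v})"
    by (rule bij_betw_byWitness[where f' = "\<lambda>w. (v, w)"]) (auto simp: out_arcs_def)
  then show ?thesis by (simp add: out_degree_def bij_betw_same_card)
qed

lemma card_parcs: "pair_graph G \<Longrightarrow> card (parcs G) = 2 * gsize G"
  unfolding pair_graph_iff gsize_def by (rule card_sym_irrefl) (auto intro: finite_subset)

lemma gconnected_iff:
  assumes "sym (parcs G)"
  shows "gconnected G \<longleftrightarrow> pverts G \<noteq> {} \<and> (\<forall>u\<in>pverts G. pverts G \<subseteq> gcomp (parcs G) (pverts G) u)"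
proof -
  let ?V = "pverts G" and ?E = "parcs G"
  have s: "symcl ?E = ?E" using assms by (auto simp: symcl_def dest: symD)
  have "(u, v) \<in> rtrancl_on ?V ?E \<longleftrightarrow> v \<in> gcomp ?E ?V u" if u: "u \<in> ?V" for u v
  proof
    assume "(u, v) \<in> rtrancl_on ?V ?E"
    then show "v \<in> gcomp ?E ?V u"
      by (induction rule: rtrancl_on_induct) (auto simp: gcomp_self intro: gcomp_step)
  next
    assume "v \<in> gcomp ?E ?V u"
    moreover have "gcomp ?E ?V u \<subseteq> {v. (u, v) \<in> rtrancl_on ?V ?E}"
      using u by (intro gcomp_least) (auto intro: rtrancl_on_into_rtrancl_on)
    ultimately show "(u, v) \<in> rtrancl_on ?V ?E" by blast
  qed
  then show ?thesis unfolding connected_conv by (auto simp: s)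
qed

lemma card_arcs_from:
  assumes "finite E" "finite A" shows "card (E \<inter> A \<times> B) = (\<Sum>a\<in>A. card (E `` {a} \<inter> B))"
proof -
  have "E \<inter> A \<times> B = (SIGMA a:A. E `` {a} \<inter> B)" by auto
  moreover have "finite (E `` {a} \<inter> B)" if "a \<in> A" for a using assms(1) by (simp add: finite_Image)
  ultimately show ?thesis using assms(2) by (simp add: card_SigmaI)
qed

text \<open>The Rayleigh quotient of the constant function 1.\<close>

lemma lam_1_ge_average:
  assumes G: "pair_graph G" and ne: "pverts G \<noteq> {}"
  shows "real (card (parcs G)) / real (gorder G) \<le> lam 1 G"
proof (rule lam_ge[where X = "\<lambda>_ _. 1"])
  have "0 < card (pverts G)" using G ne by (auto simp: pair_graph_iff card_gt_0_iff)
  then show "\<And>l. l < 1 \<Longrightarrow> 0 < (\<Sum>v\<in>pverts G. 1\<^sup>2 :: real)"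
    "\<And>l. l < 1 \<Longrightarrow> real (card (parcs G)) / real (gorder G) * (\<Sum>v\<in>pverts G. 1\<^sup>2)
      \<le> (\<Sum>(u, v)\<in>parcs G. 1 * 1)" by auto
qed (use G in \<open>auto simp: pair_graph_iff\<close>)

text \<open>If \<open>l = lam 1 G\<close> were at least \<open>r\<close>, the identity
  \<open>id\<close> would write a nonpositive number as a sum of squared differences along edges and
  of degree defects weighted by squares. All of these vanish, so \<open>x\<close> is constant by
  connectedness, nonzero, and every degree is \<open>r\<close>.\<close>

lemma lam_1_less_max_degree:
  assumes G: "pair_graph G" "gconnected G" "irregular G"
    and deg: "\<And>v. v \<in> pverts G \<Longrightarrow> vdegree G v \<le> r"
  shows "lam 1 G < real r"
proof (rule ccontr)
  let ?V = "pverts G" and ?E = "parcs G"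
  assume "\<not> lam 1 G < real r"
  define l where "l = lam 1 G"
  have le: "real r \<le> l" using \<open>\<not> lam 1 G < real r\<close> by (simp only: l_def not_less)
  have fin: "finite ?V" and EV: "?E \<subseteq> ?V \<times> ?V" and sym: "sym ?E" using G(1) by (auto simp: pair_graph_iff)
  have finE: "finite ?E" using fin EV finite_subset by blast
  have conn: "?V \<noteq> {}" "\<And>u. u \<in> ?V \<Longrightarrow> ?V \<subseteq> gcomp ?E ?V u" using G(2) gconnected_iff[OF sym] by auto
  obtain x where x: "(\<Sum>v\<in>?V. (x v)\<^sup>2) > 0" "(\<Sum>(u, v)\<in>?E. x u * x v) = l * (\<Sum>v\<in>?V. (x v)\<^sup>2)"
    unfolding l_def by (rule lam_1_eigenfunction[OF fin EV sym conn(1)])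
  have s1: "(\<Sum>(u, v)\<in>?E. (x u)\<^sup>2) = (\<Sum>u\<in>?V. real (vdegree G u) * (x u)\<^sup>2)"
  proof -
    have "?E = (SIGMA u:?V. ?E `` {u})" using EV by auto
    then have "(\<Sum>(u, v)\<in>?E. (x u)\<^sup>2) = (\<Sum>(u, v)\<in>(SIGMA u:?V. ?E `` {u}). (x u)\<^sup>2)" by simp
    also have "\<dots> = (\<Sum>u\<in>?V. \<Sum>v\<in>?E `` {u}. (x u)\<^sup>2)"
      using fin finE by (intro sum.Sigma[symmetric]) (auto intro: finite_Image)
    finally show ?thesis by (simp add: vdegree_conv)
  qed
  have s2: "(\<Sum>(u, v)\<in>?E. (x v)\<^sup>2) = (\<Sum>(u, v)\<in>?E. (x u)\<^sup>2)"
    by (rule sum.reindex_bij_witness[of _ prod.swap prod.swap]) (use sym in \<open>auto dest: symD\<close>)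
  have id: "(\<Sum>(u, v)\<in>?E. (x u - x v)\<^sup>2) + 2 * (\<Sum>u\<in>?V. (real r - real (vdegree G u)) * (x u)\<^sup>2)
     = 2 * (real r - l) * (\<Sum>v\<in>?V. (x v)\<^sup>2)"
  proof -
    have "(\<Sum>(u, v)\<in>?E. (x u - x v)\<^sup>2) = (\<Sum>(u, v)\<in>?E. (x u)\<^sup>2 + (x v)\<^sup>2 - 2 * (x u * x v))"
      by (intro sum.cong) (auto simp: power2_diff)
    also have "\<dots> = (\<Sum>(u, v)\<in>?E. (x u)\<^sup>2) + (\<Sum>(u, v)\<in>?E. (x v)\<^sup>2) - 2 * (\<Sum>(u, v)\<in>?E. x u * x v)"
      by (simp add: case_prod_unfold sum.distrib sum_subtractf sum_distrib_left)
    finally show ?thesis unfolding s2 s1 x(2)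
      by (simp add: left_diff_distrib sum_subtractf sum_distrib_left algebra_simps)
  qed
  have n1: "0 \<le> (\<Sum>(u, v)\<in>?E. (x u - x v)\<^sup>2)" by (intro sum_nonneg) auto
  have t: "0 \<le> (real r - real (vdegree G u)) * (x u)\<^sup>2" if "u \<in> ?V" for u
    using deg[OF that] by simp
  then have n2: "0 \<le> (\<Sum>u\<in>?V. (real r - real (vdegree G u)) * (x u)\<^sup>2)" by (rule sum_nonneg)
  have "2 * (real r - l) \<le> 0" using le by (simp add: mult_le_0_iff)
  then have "2 * (real r - l) * (\<Sum>v\<in>?V. (x v)\<^sup>2) \<le> 0"
    by (rule mult_nonpos_nonneg) (use x(1) in simp)
  then have z: "(\<Sum>(u, v)\<in>?E. (x u - x v)\<^sup>2) = 0"
    "(\<Sum>u\<in>?V. (real r - real (vdegree G u)) * (x u)\<^sup>2) = 0" using id n1 n2 by linarith+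
  have eq: "x u = x v" if "(u, v) \<in> ?E" for u v
    using z(1) that finE by (subst (asm) sum_nonneg_eq_0_iff) auto
  have "\<exists>w\<in>?V. x w \<noteq> 0"
  proof (rule ccontr)
    assume "\<not> ?thesis"
    then have "(\<Sum>v\<in>?V. (x v)\<^sup>2) = 0" by simp
    then show False using x(1) by simp
  qed
  then obtain w where w: "w \<in> ?V" "x w \<noteq> 0" by blast
  have "gcomp ?E ?V w \<subseteq> {v. x v = x w}" using eq by (intro gcomp_least) auto
  then have const: "x v = x w" if "v \<in> ?V" for v using conn(2)[OF w(1)] that by auto
  have "vdegree G v = r" if "v \<in> ?V" for v
  proof -
    have "(real r - real (vdegree G v)) * (x v)\<^sup>2 = 0"
      using z(2) that t fin by (subst (asm) sum_nonneg_eq_0_iff) auto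
    then show ?thesis using const[OF that] w(2) by simp
  qed
  then have "regular (int r) G" by (simp add: regular_def)
  then show False using G(3) by (auto simp: irregular_def)
qed

section \<open>Attainment of the minimum\<close>

text \<open>\<open>lam 1\<close> is a function of the adjacency matrix, and there are only finitely
  many 0-1 matrices of order at most \<open>N\<close>.\<close>

lemma finite_bounded_order_lam_1:
  assumes "\<And>H. H \<in> \<H> \<Longrightarrow> finite (pverts H) \<and> gorder H \<le> N"
  shows "finite (lam 1 ` \<H>)"
proof -
  define M where "M n S = mat n n (\<lambda>ij. if ij \<in> S then 1 else 0 :: real)" for n S
  define \<Lambda> where "\<Lambda> A = rev (sorted_list_of_multiset (proots (char_poly A))) ! 0" for A :: "real mat"
  have "lam 1 H \<in> \<Lambda> ` (\<Union>n\<le>N. M n ` Pow ({..<n} \<times> {..<n}))" if "H \<in> \<H>" for H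
  proof -
    define vs where "vs = (SOME vs. distinct vs \<and> set vs = pverts H)"
    have "\<exists>vs. distinct vs \<and> set vs = pverts H" using finite_distinct_list assms[OF that] by blast
    then have "distinct vs \<and> set vs = pverts H" unfolding vs_def by (rule someI_ex)
    then have len: "length vs \<le> N" using assms[OF that] distinct_card by metis
    let ?S = "{(i, j). i < length vs \<and> j < length vs \<and> (vs ! i, vs ! j) \<in> parcs H}"
    have "adj_mat H vs = M (length vs) ?S" by (rule eq_matI) (auto simp: adj_mat_def M_def)
    then have "adj_mat H vs \<in> (\<Union>n\<le>N. M n ` Pow ({..<n} \<times> {..<n}))" using len by auto
    moreover have "lam 1 H = \<Lambda> (adj_mat H vs)" by (simp add: lam_def adj_eigenvalues_def \<Lambda>_def vs_def)
    ultimately show ?thesis by blast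
  qed
  then have "lam 1 ` \<H> \<subseteq> \<Lambda> ` (\<Union>n\<le>N. M n ` Pow ({..<n} \<times> {..<n}))" by blast
  then show ?thesis by (rule finite_subset) auto
qed

text \<open>\<open>LEAST\<close> over the reals is informative only once a least value exists. The
  given \<open>H\<close> provides it: competitors with no larger \<open>lam 1\<close> have bounded
  order, so only finitely many values can undercut that of \<open>H\<close>.\<close>

lemma rho1_le:
  assumes H: "H \<in> rho1_graphs r t"
  shows "rho1 r t \<le> lam 1 H"
proof -
  have facts: "pair_graph H'" "gconnected H'" "irregular H'" "int (max_degree H') = r"
    "2 * int (gsize H') \<ge> r * int (gorder H') - t" "finite (pverts H')" "pverts H' \<noteq> {}"
    if "H' \<in> rho1_graphs r t" for H'
    using that gconnected_iff[of H'] by (auto simp: rho1_graphs_def pair_graph_iff)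
  let ?A = "lam 1 ` rho1_graphs r t"
  let ?\<H> = "{H' \<in> rho1_graphs r t. lam 1 H' \<le> lam 1 H}"
  have lt: "lam 1 H < real_of_int r"
  proof -
    have "vdegree H v \<le> max_degree H" if "v \<in> pverts H" for v
      using that facts(6)[OF H] by (auto simp: max_degree_def)
    then have "lam 1 H < real (max_degree H)" by (rule lam_1_less_max_degree[OF facts(1-3)[OF H]])
    then show ?thesis using facts(4)[OF H] by linarith
  qed
  \<comment> \<open>Bounds the order n' of such a competitor, because r n' - t \<le> 2e' \<le> n'
    \<open>lam 1 H\<close> and \<open>lam 1 H < r\<close>.\<close>
  define c where "c = real_of_int t / (real_of_int r - lam 1 H)"
  have "gorder H' \<le> nat \<lceil>c\<rceil>" if "H' \<in> ?\<H>" for H'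
  proof -
    have H': "H' \<in> rho1_graphs r t" "lam 1 H' \<le> lam 1 H" using that by auto
    have n: "0 < gorder H'" using facts(6,7)[OF H'(1)] by (simp add: card_gt_0_iff)
    have "real (card (parcs H')) / real (gorder H') \<le> lam 1 H"
      using lam_1_ge_average[OF facts(1,7)[OF H'(1)]] H'(2) by linarith
    then have "real (card (parcs H')) \<le> lam 1 H * real (gorder H')" using n by (simp add: field_simps)
    moreover have "real (card (parcs H')) \<ge> real_of_int r * real (gorder H') - real_of_int t"
    proof -
      have "int (card (parcs H')) \<ge> r * int (gorder H') - t"
        using facts(5)[OF H'(1)] card_parcs[OF facts(1)[OF H'(1)]] by simp
      then have "real_of_int (int (card (parcs H'))) \<ge> real_of_int (r * int (gorder H') - t)"
        by (simp only: of_int_le_iff)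
      then show ?thesis by simp
    qed
    ultimately have "real (gorder H') * (real_of_int r - lam 1 H) \<le> real_of_int t"
      by (simp add: algebra_simps)
    then have "real (gorder H') \<le> c" using lt by (simp add: c_def field_simps)
    then show ?thesis by linarith
  qed
  then have fin: "finite (lam 1 ` ?\<H>)"
    using facts(6) by (intro finite_bounded_order_lam_1[of _ "nat \<lceil>c\<rceil>"]) auto
  have ne: "lam 1 ` ?\<H> \<noteq> {}" using H by auto
  let ?m = "Min (lam 1 ` ?\<H>)"
  have m: "?m \<in> ?A" using Min_in[OF fin ne] by auto
  have low: "?m \<le> y" if "y \<in> ?A" for y
  proof (cases "y \<le> lam 1 H")
    case True
    then show ?thesis using fin that by (intro Min_le) auto
  next
    case False
    have "?m \<le> lam 1 H" using fin H by (intro Min_le) auto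
    then show ?thesis using False by linarith
  qed
  have "rho1 r t = ?m" unfolding rho1_def using m low by (rule Least_equality)
  then show ?thesis using low H by auto
qed

text \<open>Fewer than \<open>r\<close> edges leave \<open>K\<close>, so by counting some vertex of \<open>K\<close> keeps its full degree.\<close>

lemma component_test_function:
  fixes V :: "'a set" and r b :: nat
  assumes fin: "finite V" and EV: "E \<subseteq> V \<times> V" and sym: "sym E" and irr: "irrefl E"
    and reg: "\<And>v. v \<in> V \<Longrightarrow> card (E `` {v}) = r" and r: "even r"
    and KV: "K \<subseteq> V" and oddK: "odd (card K)" and conn: "comps E K = {K}"
    and b: "card (E \<inter> K \<times> (V - K)) = b" "0 < b" "b < r" "int b \<le> t"
  shows "\<exists>x :: 'a \<Rightarrow> real. (\<forall>v. v \<notin> K \<longrightarrow> x v = 0) \<and> (\<Sum>v\<in>K. (x v)\<^sup>2) > 0 \<and>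
    (\<Sum>(u, v)\<in>E \<inter> K \<times> K. x u * x v) \<ge> rho1 (int r) t * (\<Sum>v\<in>K. (x v)\<^sup>2)"
proof -
  have finK: "finite K" using KV fin finite_subset by blast
  have finE: "finite E" using fin EV finite_subset by blast
  have finI: "finite (E `` {v})" for v using finE by (simp add: finite_Image)
  have K0: "K \<noteq> {}" using oddK by auto
  \<comment> \<open>\<open>rho1\<close> compares graphs on \<open>nat\<close>, so \<open>K\<close>
    is relabelled by \<open>h\<close>.\<close>
  obtain h where h: "bij_betw h K {0..<card K}" using ex_bij_betw_finite_nat[OF finK] by blast
  have inj: "inj_on h K" using h by (simp add: bij_betw_def)
  let ?EK = "E \<inter> K \<times> K"
  define hh where "hh = (\<lambda>(u, v). (h u, h v))"
  define H where "H = \<lparr>pverts = h ` K, parcs = hh ` ?EK\<rparr>"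
  have injhh: "inj_on hh ?EK" using inj by (auto simp: inj_on_def hh_def)
  have arcH: "(h u, h v) \<in> parcs H \<longleftrightarrow> (u, v) \<in> E" if "u \<in> K" "v \<in> K" for u v
    using inj that by (auto simp: H_def hh_def inj_on_def)
  have H: "pair_graph H"
    unfolding pair_graph_iff
  proof (intro conjI)
    show "finite (pverts H)" using finK by (simp add: H_def)
    show "parcs H \<subseteq> pverts H \<times> pverts H" by (auto simp: H_def hh_def)
    show "sym (parcs H)"
    proof (rule symI)
      fix a c assume "(a, c) \<in> parcs H"
      then obtain u v where "(u, v) \<in> E" "u \<in> K" "v \<in> K" "a = h u" "c = h v"
        by (auto simp: H_def hh_def)
      then show "(c, a) \<in> parcs H" using arcH symD[OF sym] by blast
    qed
    show "irrefl (parcs H)"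
    proof (rule irreflI)
      fix a show "(a, a) \<notin> parcs H"
      proof
        assume "(a, a) \<in> parcs H"
        then obtain u v where "(u, v) \<in> E" "u \<in> K" "v \<in> K" "h u = h v"
          by (auto simp: H_def hh_def)
        then show False using inj irr by (auto simp: inj_on_def irrefl_def)
      qed
    qed
  qed
  have symH: "sym (parcs H)" using H by (simp add: pair_graph_iff)
  have ordH: "gorder H = card K" using inj by (simp add: H_def card_image)
  have degH: "vdegree H (h u) = card (E `` {u} \<inter> K)" if "u \<in> K" for u
  proof -
    have "parcs H `` {h u} = h ` (E `` {u} \<inter> K)"
      using that inj by (auto simp: H_def hh_def inj_on_def)
    then show ?thesis using inj by (simp add: vdegree_conv card_image inj_on_subset)
  qed
  have split: "card (E `` {u} \<inter> K) + card (E `` {u} \<inter> (V - K)) = r" if "u \<in> K" for u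
  proof -
    have "card (E `` {u} \<inter> K) + card (E `` {u} \<inter> (V - K)) = card ((E `` {u} \<inter> K) \<union> (E `` {u} \<inter> (V - K)))"
      using finI by (intro card_Un_disjoint[symmetric]) auto
    also have "(E `` {u} \<inter> K) \<union> (E `` {u} \<inter> (V - K)) = E `` {u}" using EV by auto
    finally show ?thesis using reg that KV by auto
  qed
  have sumb: "(\<Sum>u\<in>K. card (E `` {u} \<inter> (V - K))) = b"
    using card_arcs_from[OF finE finK, of "V - K"] b(1) by simp
  have "card ?EK + b = (\<Sum>u\<in>K. r)"
    unfolding card_arcs_from[OF finE finK] sumb[symmetric] sum.distrib[symmetric]
    by (intro sum.cong refl split)
  then have cEK: "card ?EK + b = r * card K" by simp
  have full: "\<exists>u\<in>K. card (E `` {u} \<inter> K) = r"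
  proof (rule ccontr)
    assume "\<not> ?thesis"
    then have pos: "1 \<le> card (E `` {u} \<inter> (V - K))" if "u \<in> K" for u using split[OF that] that by force
    have "card K \<le> b"
      using sum_mono[of K "\<lambda>_. 1" "\<lambda>u. card (E `` {u} \<inter> (V - K))"] pos sumb by simp
    then have kr: "card K < r" using b(3) by simp
    \<comment> \<open>A vertex has at most \<open>card K - 1\<close> neighbours inside
      \<open>K\<close>. For an order a with 1 \<le> a < r this sends at least a(r + 1 - a) \<ge> r
      edges out of \<open>K\<close>, more than the \<open>b\<close> available.\<close>
    have "r + 1 - card K \<le> card (E `` {u} \<inter> (V - K))" if u: "u \<in> K" for u
    proof -
      have "E `` {u} \<inter> K \<subseteq> K - {u}" using irr by (auto simp: irrefl_def)
      then have "card (E `` {u} \<inter> K) \<le> card K - 1"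
        using card_mono[of "K - {u}" "E `` {u} \<inter> K"] finK u by simp
      moreover have "1 \<le> card K" using K0 finK by (simp add: Suc_leI card_gt_0_iff)
      ultimately show ?thesis using split[OF u] by linarith
    qed
    then have "card K * (r + 1 - card K) \<le> b"
      using sum_mono[of K "\<lambda>_. r + 1 - card K" "\<lambda>u. card (E `` {u} \<inter> (V - K))"] sumb by simp
    moreover have "r \<le> card K * (r + 1 - card K)"
    proof -
      define d where "d = r - card K"
      have "card K \<ge> 1" using K0 finK by (simp add: Suc_leI card_gt_0_iff)
      then obtain c where c: "card K = Suc c" by (cases "card K") auto
      have "r = Suc c + d" using kr c by (simp add: d_def)
      then show ?thesis by (simp add: c)
    qed
    ultimately show False using b(3) by simp
  qed
  then obtain u0 where u0: "u0 \<in> K" "card (E `` {u0} \<inter> K) = r" by blast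
  have le: "card (E `` {u} \<inter> K) \<le> r" if "u \<in> K" for u using split[OF that] by simp
  have "Max (vdegree H ` pverts H) = r"
  proof (rule Max_eqI)
    show "finite (vdegree H ` pverts H)" using finK by (simp add: H_def)
    show "y \<le> r" if "y \<in> vdegree H ` pverts H" for y using that degH le by (auto simp: H_def)
    show "r \<in> vdegree H ` pverts H" using degH[OF u0(1)] u0 by (force simp: H_def)
  qed
  then have maxH: "int (max_degree H) = int r" by (simp add: max_degree_def)
  have irregH: "irregular H"
    unfolding irregular_def
  proof
    assume "\<exists>d. regular d H"
    then have all: "card (E `` {u} \<inter> K) = r" if "u \<in> K" for u
    proof -
      obtain d where "\<forall>w\<in>pverts H. int (vdegree H w) = d"
        using \<open>\<exists>d. regular d H\<close> by (auto simp: regular_def)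
      then have "int (vdegree H (h u)) = int (vdegree H (h u0))"
        using that u0(1) by (simp add: H_def)
      then show ?thesis using degH that u0 by simp
    qed
    then have "card (E `` {u} \<inter> (V - K)) = 0" if "u \<in> K" for u using split[OF that] that by auto
    then show False using sumb b(2) by simp
  qed
  have connH: "gconnected H"
    unfolding gconnected_iff[OF symH]
  proof (intro conjI ballI)
    show "pverts H \<noteq> {}" using K0 by (simp add: H_def)
    fix w assume "w \<in> pverts H"
    then obtain u where u: "u \<in> K" "w = h u" by (auto simp: H_def)
    have "K = gcomp E K u" using gcomp_in_comps[OF u(1), of E] conn by simp
    also have "\<dots> \<subseteq> {v. h v \<in> gcomp (parcs H) (pverts H) w}"
    proof (rule gcomp_least)
      show "u \<in> {v. h v \<in> gcomp (parcs H) (pverts H) w}" using u gcomp_self by auto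
      fix a c assume *: "a \<in> {v. h v \<in> gcomp (parcs H) (pverts H) w}" "a \<in> K" "c \<in> K" "(a, c) \<in> E"
      then have "(h a, h c) \<in> parcs H" using arcH by blast
      then show "c \<in> {v. h v \<in> gcomp (parcs H) (pverts H) w}"
        using * gcomp_step[of "h a" "parcs H" "pverts H" w "h c"] by (auto simp: H_def)
    qed
    finally show "pverts H \<subseteq> gcomp (parcs H) (pverts H) w" by (auto simp: H_def)
  qed
  have "card (parcs H) = card ?EK" using injhh by (simp add: H_def card_image)
  then have "2 * int (gsize H) = int (card ?EK)" using card_parcs[OF H] by simp
  moreover have "int (card ?EK) + int b = int r * int (gorder H)"
    unfolding ordH using cEK by (metis of_nat_add of_nat_mult)
  ultimately have sizeH: "2 * int (gsize H) \<ge> int r * int (gorder H) - t" using b(4) by linarith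
  have "\<not> [int (gorder H) = int r] (mod 2)"
    using oddK r by (simp add: ordH cong_def even_iff_mod_2_eq_zero odd_iff_mod_2_eq_one) presburger
  then have "H \<in> rho1_graphs (int r) t"
    using H connH irregH maxH sizeH by (simp add: rho1_graphs_def)
  then have rho: "rho1 (int r) t \<le> lam 1 H" by (rule rho1_le)
  have H': "finite (pverts H)" "parcs H \<subseteq> pverts H \<times> pverts H" "pverts H \<noteq> {}"
    using H K0 by (auto simp: pair_graph_iff H_def)
  obtain y where y: "(\<Sum>v\<in>pverts H. (y v)\<^sup>2) > 0"
    "(\<Sum>(u, v)\<in>parcs H. y u * y v) = lam 1 H * (\<Sum>v\<in>pverts H. (y v)\<^sup>2)"
    by (rule lam_1_eigenfunction[OF H'(1,2) symH H'(3)])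
  define x where "x v = (if v \<in> K then y (h v) else 0)" for v
  have 1: "(\<Sum>v\<in>K. (x v)\<^sup>2) = (\<Sum>v\<in>pverts H. (y v)\<^sup>2)"
    using sum.reindex[OF inj, of "\<lambda>v. (y v)\<^sup>2"] by (simp add: H_def x_def)
  have "(\<Sum>(u, v)\<in>?EK. x u * x v) = (\<Sum>(u, v)\<in>parcs H. y u * y v)"
  proof -
    have "(\<Sum>(u, v)\<in>parcs H. y u * y v) = (\<Sum>e\<in>?EK. (\<lambda>(u, v). y u * y v) (hh e))"
      using sum.reindex[OF injhh, of "\<lambda>(u, v). y u * y v"] by (simp add: H_def)
    also have "\<dots> = (\<Sum>(u, v)\<in>?EK. x u * x v)"
      by (intro sum.cong) (auto simp: hh_def x_def)
    finally show ?thesis by simp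
  qed
  then have "(\<Sum>(u, v)\<in>?EK. x u * x v) \<ge> rho1 (int r) t * (\<Sum>v\<in>K. (x v)\<^sup>2)"
    using y rho 1 by (simp add: mult_right_mono)
  then show ?thesis using 1 y(1) by (intro exI[of _ x]) (auto simp: x_def)
qed

section \<open>Components with few boundary edges\<close>

text \<open>The target \<open>k + 1\<close> on \<open>L\<close> turns the two degrees
  \<open>f\<close> and \<open>f - 2\<close> permitted there into \<open>k + 1\<close> and
  \<open>k - 1\<close>. The final parity clause is confined to components avoiding \<open>L\<close>,
  on which the target is \<open>k\<close> throughout.\<close>

lemma light_components:
  fixes V :: "'a set" and r k :: nat
  assumes fin: "finite V" and EV: "E \<subseteq> V \<times> V" and sym: "sym E" and irr: "irrefl E"
    and reg: "\<And>v. v \<in> V \<Longrightarrow> card (E `` {v}) = r" and conn: "comps E V = {V}"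
    and k: "0 < k" "k < r"
    and even: "even (\<Sum>v\<in>V. if v \<in> L then k + 1 else k)"
    and nofac: "\<not> (\<exists>F\<subseteq>E. sym F \<and>
      (\<forall>v\<in>V. if v \<in> L then card (F `` {v}) = k + 1 \<or> card (F `` {v}) + 1 = k else card (F `` {v}) = k))"
  obtains S T \<Q> where "S \<subseteq> V" "T \<subseteq> V" "S \<inter> T = {}" "\<Q> \<subseteq> comps E (V - S - T)" "3 \<le> card \<Q>"
    "\<And>K. K \<in> \<Q> \<Longrightarrow> k * card (E \<inter> S \<times> K) + (r - k) * card (E \<inter> T \<times> K) < r"
    "\<And>K. K \<in> \<Q> \<Longrightarrow> 0 < k * card (E \<inter> S \<times> K) + (r - k) * card (E \<inter> T \<times> K)"
    "\<And>K. K \<in> \<Q> \<Longrightarrow> K \<inter> L = {} \<Longrightarrow> odd (k * card K + r * card K + card (E \<inter> S \<times> K))"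
proof -
  let ?f = "\<lambda>v. if v \<in> L then k + 1 else k"
  have finE: "finite E" using fin EV finite_subset by blast
  have fromV: "card (E \<inter> A \<times> V) = r * card A" if "A \<subseteq> V" for A
  proof -
    have "card (E \<inter> A \<times> V) = (\<Sum>a\<in>A. card (E `` {a} \<inter> V))"
      using finite_subset[OF that fin] by (rule card_arcs_from[OF finE])
    also have "\<dots> = (\<Sum>a\<in>A. r)"
    proof (rule sum.cong[OF refl])
      fix a assume "a \<in> A"
      moreover have "E `` {a} \<inter> V = E `` {a}" using EV by auto
      ultimately show "card (E `` {a} \<inter> V) = r" using reg that by auto
    qed
    finally show ?thesis by simp
  qed
  have nofac': "\<not> (\<exists>F\<subseteq>E. sym F \<and>
      (\<forall>v\<in>V. card (F `` {v}) = ?f v \<or> v \<in> L \<and> card (F `` {v}) + 2 = ?f v))"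
  proof
    assume "\<exists>F\<subseteq>E. sym F \<and> (\<forall>v\<in>V. card (F `` {v}) = ?f v \<or> v \<in> L \<and> card (F `` {v}) + 2 = ?f v)"
    then obtain F where F: "F \<subseteq> E" "sym F"
      "\<And>v. v \<in> V \<Longrightarrow> card (F `` {v}) = ?f v \<or> v \<in> L \<and> card (F `` {v}) + 2 = ?f v" by blast
    have "if v \<in> L then card (F `` {v}) = k + 1 \<or> card (F `` {v}) + 1 = k else card (F `` {v}) = k"
      if "v \<in> V" for v using F(3)[OF that] by auto
    then show False using nofac F(1,2) by blast
  qed
  have noiso: "E `` {v} \<noteq> {}" if "v \<in> V" for v using reg[OF that] k by auto
  have f1: "1 \<le> ?f v" for v using k by auto
  have f2: "2 \<le> ?f v" if "v \<in> L" for v using k that by auto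
  obtain S T where ST: "S \<subseteq> V" "T \<subseteq> V" "S \<inter> T = {}"
    and bar: "(\<Sum>v\<in>S. ?f v) + card (E \<inter> T \<times> V) + 2 \<le>
       (\<Sum>v\<in>T. if v \<in> L then ?f v - 2 else ?f v) + card (E \<inter> S \<times> T)
       + card {K \<in> comps E (V - S - T).
           odd ((\<Sum>v\<in>K. ?f v) + card (E \<inter> K \<times> V) + card (E \<inter> S \<times> K))}"
    by (rule parity_factor[OF fin EV sym irr noiso f1 f2 even nofac'])
  define R where "R = V - S - T"
  define \<K> where "\<K> = {K \<in> comps E R. odd ((\<Sum>v\<in>K. ?f v) + card (E \<inter> K \<times> V) + card (E \<inter> S \<times> K))}"
  have finR: "finite R" using fin by (simp add: R_def)
  have fin\<K>: "finite \<K>" using finite_comps[OF finR, of E] by (simp add: \<K>_def)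
  define w where "w K = k * card (E \<inter> S \<times> K) + (r - k) * card (E \<inter> T \<times> K)" for K
  have KR: "K \<subseteq> R" if "K \<in> \<K>" for K using that comps_subset by (auto simp: \<K>_def)
  have disj: "K \<inter> K' = {}" if "K \<in> \<K>" "K' \<in> \<K>" "K \<noteq> K'" for K K'
    using that comps_eq[OF sym, of K R K'] by (auto simp: \<K>_def)
  have out: "(\<Sum>K\<in>\<K>. card (E \<inter> A \<times> K)) + card (E \<inter> A \<times> B) \<le> r * card A"
    if A: "A \<subseteq> V" and B: "B \<inter> R = {}" for A B
  proof -
    have "(\<Sum>K\<in>\<K>. card (E \<inter> A \<times> K)) = card (\<Union>K\<in>\<K>. E \<inter> A \<times> K)"
      using fin\<K> finE disj by (intro card_UN_disjoint[symmetric]) auto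
    also have "\<dots> + card (E \<inter> A \<times> B) = card ((\<Union>K\<in>\<K>. E \<inter> A \<times> K) \<union> (E \<inter> A \<times> B))"
      using fin\<K> finE KR B by (intro card_Un_disjoint[symmetric]) auto
    also have "\<dots> \<le> card (E \<inter> A \<times> V)"
      using finE EV by (intro card_mono) auto
    finally show ?thesis using fromV[OF A] by simp
  qed
  have eTS: "card (E \<inter> T \<times> S) = card (E \<inter> S \<times> T)"
    by (rule bij_betw_same_card[of prod.swap], rule bij_betw_byWitness[where f' = prod.swap])
      (use sym in \<open>auto dest: symD\<close>)
  have oS: "(\<Sum>K\<in>\<K>. card (E \<inter> S \<times> K)) + card (E \<inter> S \<times> T) \<le> r * card S"
    using ST by (intro out) (auto simp: R_def)
  have oT: "(\<Sum>K\<in>\<K>. card (E \<inter> T \<times> K)) + card (E \<inter> S \<times> T) \<le> r * card T"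
    unfolding eTS[symmetric] using ST by (intro out) (auto simp: R_def)
  \<comment> \<open>On \<open>L\<close> the barrier counts \<open>k + 1\<close> at \<open>S\<close>
    and \<open>k - 1\<close> at \<open>T\<close>; both deviate from \<open>k\<close> in the
    favourable direction, so the exceptional vertices drop out of the estimate.\<close>
  have fS: "k * card S \<le> (\<Sum>v\<in>S. ?f v)"
  proof -
    have "(\<Sum>v\<in>S. k) \<le> (\<Sum>v\<in>S. ?f v)" by (rule sum_mono) simp
    then show ?thesis by (simp add: mult.commute)
  qed
  have fT: "(\<Sum>v\<in>T. if v \<in> L then ?f v - 2 else ?f v) \<le> k * card T"
  proof -
    have "(\<Sum>v\<in>T. if v \<in> L then ?f v - 2 else ?f v) \<le> (\<Sum>v\<in>T. k)" by (rule sum_mono) simp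
    then show ?thesis by (simp add: mult.commute)
  qed
  obtain d where d: "r = k + d" "0 < d" using k(2) less_imp_add_positive by blast
  have "k * card S + r * card T + 2 \<le> k * card T + card (E \<inter> S \<times> T) + card \<K>"
    using bar fS fT fromV[OF ST(2)] unfolding R_def[symmetric] \<K>_def[symmetric] by linarith
  then have main: "k * card S + d * card T + 2 \<le> card (E \<inter> S \<times> T) + card \<K>"
    by (simp add: d(1) add_mult_distrib)
  \<comment> \<open>Combine \<open>k\<close> times \<open>oS\<close>, \<open>d\<close> times
    \<open>oT\<close> and \<open>r\<close> times \<open>main\<close>; the edges between
    \<open>S\<close> and \<open>T\<close> cancel because \<open>k + d = r\<close>.\<close>
  have "sum w \<K> + 2 * r \<le> r * card \<K>"
  proof -
    have "sum w \<K> = k * (\<Sum>K\<in>\<K>. card (E \<inter> S \<times> K)) + d * (\<Sum>K\<in>\<K>. card (E \<inter> T \<times> K))"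
      by (simp add: w_def sum.distrib sum_distrib_left d(1))
    moreover have "k * ((\<Sum>K\<in>\<K>. card (E \<inter> S \<times> K)) + card (E \<inter> S \<times> T)) \<le> k * (r * card S)"
      using oS by (rule mult_le_mono2)
    moreover have "d * ((\<Sum>K\<in>\<K>. card (E \<inter> T \<times> K)) + card (E \<inter> S \<times> T)) \<le> d * (r * card T)"
      using oT by (rule mult_le_mono2)
    moreover have "r * (k * card S + d * card T + 2) \<le> r * (card (E \<inter> S \<times> T) + card \<K>)"
      using main by (rule mult_le_mono2)
    moreover have "k * (r * card S) + d * (r * card T) + 2 * r = r * (k * card S + d * card T + 2)"
      by (simp add: algebra_simps)
    moreover have "r * (card (E \<inter> S \<times> T) + card \<K>) =
        k * card (E \<inter> S \<times> T) + d * card (E \<inter> S \<times> T) + r * card \<K>"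
      by (simp add: d(1) algebra_simps)
    ultimately show ?thesis unfolding distrib_left by linarith
  qed
  note ineq = this
  \<comment> \<open>A component of weight 0 has no edge leaving it, so it is all of \<open>V\<close>
    and the only one; then \<open>ineq\<close> would read \<open>2 * r \<le> r\<close>.\<close>
  have wpos: "0 < w K" if K: "K \<in> \<K>" for K
  proof (rule ccontr)
    assume "\<not> 0 < w K"
    then have "card (E \<inter> S \<times> K) = 0" "card (E \<inter> T \<times> K) = 0"
      using k by (auto simp: w_def)
    then have e: "E \<inter> S \<times> K = {}" "E \<inter> T \<times> K = {}" using finE by auto
    have Kc: "K \<in> comps E R" using K by (simp add: \<K>_def)
    have "K \<in> comps E V"
    proof (rule comps_superset[OF sym Kc])
      show "K \<subseteq> V" using KR[OF K] by (auto simp: R_def)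
      fix a b assume ab: "a \<in> K" "b \<in> V - K"
      show "(a, b) \<notin> E"
      proof
        assume "(a, b) \<in> E"
        moreover from this have "(b, a) \<in> E" by (rule symD[OF sym])
        moreover have "b \<notin> R" using comps_step[OF sym Kc ab(1)] ab(2) \<open>(a, b) \<in> E\<close> by blast
        ultimately show False using ab e by (auto simp: R_def)
      qed
    qed
    then have KV: "K = V" using conn by simp
    have "K' = K" if K': "K' \<in> \<K>" for K'
    proof (rule ccontr)
      assume "K' \<noteq> K"
      then have "K' \<inter> V = {}" using disj[OF K' K] KV by simp
      moreover have "K' \<noteq> {}" using K' comps_nonempty by (auto simp: \<K>_def)
      ultimately show False using KR[OF K'] by (auto simp: R_def)
    qed
    then have "\<K> = {K}" using K by blast
    then show False using ineq k by simp
  qed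
  define \<Q> where "\<Q> = {K \<in> \<K>. w K < r}"
  have Qsub: "\<Q> \<subseteq> \<K>" by (auto simp: \<Q>_def)
  then have fin\<Q>: "finite \<Q>" using fin\<K> finite_subset by blast
  have "3 \<le> card \<Q>"
  proof -
    \<comment> \<open>Each heavy component uses up its share \<open>r\<close> of
      \<open>r * card \<K>\<close>. The light ones must leave room for \<open>2 * r\<close>, and
      since their weights are positive, two of them are too few.\<close>
    have "sum w \<K> = sum w \<Q> + sum w (\<K> - \<Q>)"
      using fin\<K> Qsub by (metis add.commute sum.subset_diff)
    moreover have "card \<Q> \<le> sum w \<Q>"
    proof -
      have "(\<Sum>K\<in>\<Q>. 1) \<le> sum w \<Q>" using wpos Qsub by (intro sum_mono) (auto simp: Suc_le_eq)
      then show ?thesis by simp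
    qed
    moreover have "r * card (\<K> - \<Q>) \<le> sum w (\<K> - \<Q>)"
    proof -
      have "(\<Sum>K\<in>\<K> - \<Q>. r) \<le> sum w (\<K> - \<Q>)" by (intro sum_mono) (auto simp: \<Q>_def)
      then show ?thesis by (simp add: mult.commute)
    qed
    moreover have "card \<K> = card \<Q> + card (\<K> - \<Q>)"
      using fin\<K> Qsub fin\<Q> by (metis card_Diff_subset card_mono le_add_diff_inverse)
    then have "r * card \<K> = r * card \<Q> + r * card (\<K> - \<Q>)" by (simp add: add_mult_distrib2)
    ultimately have le: "card \<Q> + 2 * r \<le> r * card \<Q>" using ineq by linarith
    show ?thesis
    proof (rule ccontr)
      assume "\<not> 3 \<le> card \<Q>"
      then have "card \<Q> \<le> 2" by simp
      then have "r * card \<Q> \<le> r * 2" by (rule mult_le_mono2)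
      then have "card \<Q> = 0" using le by linarith
      then show False using le k by simp
    qed
  qed
  note Q3 = this
  have Qodd: "odd (k * card K + r * card K + card (E \<inter> S \<times> K))" if "K \<in> \<Q>" "K \<inter> L = {}" for K
  proof -
    have K: "K \<in> \<K>" "K \<subseteq> V" using that(1) Qsub KR by (auto simp: R_def)
    have "(\<Sum>v\<in>K. ?f v) = (\<Sum>v\<in>K. k)" using that(2) by (intro sum.cong) auto
    then show ?thesis using K(1) fromV[OF K(2)] by (simp add: \<K>_def mult.commute)
  qed
  have "\<Q> \<subseteq> comps E (V - S - T)" using Qsub by (auto simp: \<K>_def R_def)
  then show thesis
  proof (rule that[OF ST _ Q3 _ _ Qodd])
    show "k * card (E \<inter> S \<times> K) + (r - k) * card (E \<inter> T \<times> K) < r" if "K \<in> \<Q>" for K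
      using that by (simp add: \<Q>_def w_def)
    show "0 < k * card (E \<inter> S \<times> K) + (r - k) * card (E \<inter> T \<times> K)" if "K \<in> \<Q>" for K
      using wpos[OF subsetD[OF Qsub that]] by (simp only: w_def)
  qed
qed

text \<open>Generic in \<open>j\<close>, since two components are available for odd order and three
  for even order. As \<open>par\<close> is required of every member of \<open>\<Q>\<close>, a
  component containing an exceptional vertex has to be discarded beforehand.\<close>

lemma lam_ge_rho1_of_light_components:
  fixes G :: "'a pair_pre_digraph" and r k j :: nat
  assumes G: "pair_graph G" and reg: "\<And>v. v \<in> pverts G \<Longrightarrow> card (parcs G `` {v}) = r"
    and k: "0 < k" "k < r" and r: "even r"
    and ST: "S \<subseteq> pverts G" "T \<subseteq> pverts G" "S \<inter> T = {}"
    and Q: "\<Q> \<subseteq> comps (parcs G) (pverts G - S - T)" and j: "1 \<le> j" "j \<le> card \<Q>"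
    and light: "\<And>K. K \<in> \<Q> \<Longrightarrow> k * card (parcs G \<inter> S \<times> K) + (r - k) * card (parcs G \<inter> T \<times> K) < r"
    and pos: "\<And>K. K \<in> \<Q> \<Longrightarrow> 0 < k * card (parcs G \<inter> S \<times> K) + (r - k) * card (parcs G \<inter> T \<times> K)"
    and par: "\<And>K. K \<in> \<Q> \<Longrightarrow> odd (k * card K + r * card K + card (parcs G \<inter> S \<times> K))"
    and m: "int r \<le> m * int k" "int r \<le> m * int (r - k)" "m0 \<in> {m, m - 1}" "odd m0"
  shows "rho1 (int r) (m0 - 1) \<le> lam j G"
proof -
  let ?V = "pverts G" and ?E = "parcs G"
  let ?\<rho> = "rho1 (int r) (m0 - 1)"
  have fin: "finite ?V" and EV: "?E \<subseteq> ?V \<times> ?V" and sym: "sym ?E" and irr: "irrefl ?E"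
    using G by (auto simp: pair_graph_iff)
  have finE: "finite ?E" using fin EV finite_subset by blast
  define R where "R = ?V - S - T"
  have QR: "K \<in> comps ?E R" if "K \<in> \<Q>" for K using Q that by (auto simp: R_def)
  have "\<exists>x :: 'a \<Rightarrow> real. (\<forall>v. v \<notin> K \<longrightarrow> x v = 0) \<and> (\<Sum>v\<in>K. (x v)\<^sup>2) > 0 \<and>
    (\<Sum>(u, v)\<in>?E \<inter> K \<times> K. x u * x v) \<ge> ?\<rho> * (\<Sum>v\<in>K. (x v)\<^sup>2)" if K: "K \<in> \<Q>" for K
  proof -
    have KR: "K \<subseteq> R" using comps_subset[OF QR[OF K]] .
    then have KV: "K \<subseteq> ?V" by (auto simp: R_def)
    have finK: "finite K" using KV fin finite_subset by blast
    define s where "s = card (?E \<inter> S \<times> K)"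
    define t where "t = card (?E \<inter> T \<times> K)"
    define b where "b = card (?E \<inter> K \<times> (?V - K))"
    obtain d where d: "r = k + d" "0 < d" using k(2) less_imp_add_positive by blast
    have l: "k * s + d * t < r" "0 < k * s + d * t" using light[OF K] pos[OF K] d(1) by (simp_all add: s_def t_def)
    have b: "b = s + t"
    proof -
      have "?E \<inter> K \<times> (?V - K) = prod.swap ` ((?E \<inter> S \<times> K) \<union> (?E \<inter> T \<times> K))"
      proof (rule Set.set_eqI, clarify)
        fix a c
        show "(a, c) \<in> ?E \<inter> K \<times> (?V - K) \<longleftrightarrow> (a, c) \<in> prod.swap ` ((?E \<inter> S \<times> K) \<union> (?E \<inter> T \<times> K))"
        proof
          assume ac: "(a, c) \<in> ?E \<inter> K \<times> (?V - K)"
          then have "c \<in> S \<union> T" using comps_step[OF sym QR[OF K], of a c] by (auto simp: R_def)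
          then have "(c, a) \<in> (?E \<inter> S \<times> K) \<union> (?E \<inter> T \<times> K)" using ac symD[OF sym] by blast
          then show "(a, c) \<in> prod.swap ` ((?E \<inter> S \<times> K) \<union> (?E \<inter> T \<times> K))" by force
        next
          assume "(a, c) \<in> prod.swap ` ((?E \<inter> S \<times> K) \<union> (?E \<inter> T \<times> K))"
          then show "(a, c) \<in> ?E \<inter> K \<times> (?V - K)"
            using symD[OF sym] KR ST by (auto simp: R_def)
        qed
      qed
      then have "b = card ((?E \<inter> S \<times> K) \<union> (?E \<inter> T \<times> K))"
        by (simp add: b_def card_image)
      also have "\<dots> = s + t"
        unfolding s_def t_def using finE ST(3) by (intro card_Un_disjoint) auto
      finally show ?thesis .
    qed
    have rK: "card (?E \<inter> K \<times> K) + b = r * card K"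
    proof -
      have "card (?E \<inter> K \<times> K) + b = card ((?E \<inter> K \<times> K) \<union> (?E \<inter> K \<times> (?V - K)))"
        unfolding b_def using finE by (intro card_Un_disjoint[symmetric]) auto
      also have "(?E \<inter> K \<times> K) \<union> (?E \<inter> K \<times> (?V - K)) = ?E \<inter> K \<times> ?V" using KV by auto
      also have "card \<dots> = (\<Sum>a\<in>K. card (?E `` {a} \<inter> ?V))" by (rule card_arcs_from[OF finE finK])
      also have "\<dots> = (\<Sum>a\<in>K. r)"
      proof (rule sum.cong[OF refl])
        fix a assume "a \<in> K"
        moreover have "?E `` {a} \<inter> ?V = ?E `` {a}" using EV by auto
        ultimately show "card (?E `` {a} \<inter> ?V) = r" using reg KV by auto
      qed
      finally show ?thesis by simp
    qed
    have "sym (?E \<inter> K \<times> K)" "irrefl (?E \<inter> K \<times> K)" using sym irr by (auto simp: sym_def irrefl_def)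
    then have "even (card (?E \<inter> K \<times> K))" using card_sym_irrefl[of "?E \<inter> K \<times> K"] finE by simp
    then have evb: "even b" using rK r by (metis even_add even_mult_iff)
    have sle: "s \<le> k * s" and tle: "t \<le> d * t" using k d by simp_all
    have br: "b < r" using l sle tle b by linarith
    have bpos: "0 < b" using l(2) b by (cases "s = 0") auto
    have oddK: "odd (card K)"
    proof
      assume ev: "even (card K)"
      then have "odd s" using par[OF K] by (simp add: s_def)
      then have "odd t" using evb b by simp
      then have "1 \<le> s" "1 \<le> t" using \<open>odd s\<close> by (auto simp: Suc_leI odd_pos)
      then have "k * 1 \<le> k * s" "d * 1 \<le> d * t" by (simp_all only: mult_le_mono2)
      then show False using l d by linarith
    qed
    have bm: "int b < m"
    proof (rule ccontr)
      assume "\<not> int b < m"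
      then have mb: "m \<le> int b" by simp
      \<comment> \<open>The bound r/m on the weight of an edge, cleared of denominators: r b \<le>
        m(ks + dt) < m r.\<close>
      have "int r * int s \<le> (m * int k) * int s" "int r * int t \<le> (m * int d) * int t"
        using m(1,2) d(1) by (intro mult_right_mono; simp)+
      then have "int r * int b \<le> m * (int k * int s + int d * int t)"
        by (simp add: b algebra_simps)
      moreover have "m > 0"
      proof (rule ccontr)
        assume "\<not> m > 0"
        then have "m * int k \<le> 0" using k by (simp add: mult_le_0_iff)
        then show False using m(1) k by linarith
      qed
      moreover have "int k * int s + int d * int t < int r" using l(1) by (metis of_nat_add of_nat_less_iff of_nat_mult)
      ultimately have "int r * int b < m * int r" using mult_strict_left_mono le_less_trans by blast
      then show False using mb k by (simp add: mult.commute)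
    qed
    have bt: "int b \<le> m0 - 1"
      using m(3,4) bm evb by (auto simp: elim!: oddE evenE)
    show ?thesis
      using component_test_function[OF fin EV sym irr reg r KV oddK comps_of_comp[OF sym QR[OF K]]
          _ bpos br bt] b_def by blast
  qed
  then have "\<exists>X :: 'a set \<Rightarrow> 'a \<Rightarrow> real. \<forall>K\<in>\<Q>. (\<forall>v. v \<notin> K \<longrightarrow> X K v = 0) \<and>
    (\<Sum>v\<in>K. (X K v)\<^sup>2) > 0 \<and>
    (\<Sum>(u, v)\<in>?E \<inter> K \<times> K. X K u * X K v) \<ge> ?\<rho> * (\<Sum>v\<in>K. (X K v)\<^sup>2)"
    by (intro bchoice) blast
  then obtain X where X: "\<And>K v. K \<in> \<Q> \<Longrightarrow> v \<notin> K \<Longrightarrow> X K v = 0"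
    "\<And>K. K \<in> \<Q> \<Longrightarrow> (\<Sum>v\<in>K. (X K v)\<^sup>2) > (0 :: real)"
    "\<And>K. K \<in> \<Q> \<Longrightarrow> (\<Sum>(u, v)\<in>?E \<inter> K \<times> K. X K u * X K v) \<ge> ?\<rho> * (\<Sum>v\<in>K. (X K v)\<^sup>2)"
    by blast
  have finQ: "finite \<Q>" using Q finite_comps[of "?V - S - T" ?E] fin finite_subset by blast
  obtain h where h: "bij_betw h {0..<card \<Q>} \<Q>" using ex_bij_betw_nat_finite[OF finQ] by blast
  have hQ: "h l \<in> \<Q>" if "l < j" for l using bij_betwE[OF h] that j(2) by auto
  have hinj: "h l \<noteq> h l'" if "l < j" "l' < j" "l \<noteq> l'" for l l'
    using h that j(2) by (auto simp: bij_betw_def inj_on_def)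
  have zero: "X (h l) u * X (h l') v = 0" if "l < j" "l' < j" "l \<noteq> l'" "u = v \<or> (u, v) \<in> ?E" for l l' u v
  proof (rule ccontr)
    assume "X (h l) u * X (h l') v \<noteq> 0"
    then have uv: "u \<in> h l" "v \<in> h l'" using X(1) hQ that by (metis mult_zero_left mult_zero_right)+
    have c: "h l \<in> comps ?E R" "h l' \<in> comps ?E R" using QR hQ that by auto
    have "v \<in> h l"
      using that(4) uv comps_step[OF sym c(1) uv(1), of v] comps_subset[OF c(2)] by auto
    then show False using comps_eq[OF sym c, of v] uv(2) hinj[OF that(1-3)] by blast
  qed
  have subV: "h l \<subseteq> ?V" if "l < j" for l using comps_subset[OF QR[OF hQ[OF that]]] by (auto simp: R_def)
  have sqV: "(\<Sum>v\<in>?V. (X (h l) v)\<^sup>2) = (\<Sum>v\<in>h l. (X (h l) v)\<^sup>2)" if "l < j" for l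
    using fin subV[OF that] X(1)[OF hQ[OF that]] by (intro sum.mono_neutral_right) auto
  show ?thesis
  proof (rule lam_ge[OF fin EV sym j(1), where X = "\<lambda>l. X (h l)"])
    show "0 < (\<Sum>v\<in>?V. (X (h l) v)\<^sup>2)" if "l < j" for l
      using X(2)[OF hQ[OF that]] sqV[OF that] by simp
    show "(\<Sum>v\<in>?V. X (h l) v * X (h l') v) = 0" if "l < j" "l' < j" "l \<noteq> l'" for l l'
      using zero[OF that] by (intro sum.neutral) auto
    show "(\<Sum>(u, v)\<in>?E. X (h l) u * X (h l') v) = 0" if "l < j" "l' < j" "l \<noteq> l'" for l l'
      using zero[OF that] by (intro sum.neutral) auto
    show "?\<rho> * (\<Sum>v\<in>?V. (X (h l) v)\<^sup>2) \<le> (\<Sum>(u, v)\<in>?E. X (h l) u * X (h l) v)" if "l < j" for l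
    proof -
      have "v \<in> h l" if "X (h l) v \<noteq> 0" for v using X(1)[OF hQ[OF \<open>l < j\<close>]] that by blast
      then have "(\<Sum>(u, v)\<in>?E. X (h l) u * X (h l) v) = (\<Sum>(u, v)\<in>?E \<inter> h l \<times> h l. X (h l) u * X (h l) v)"
        using finE by (intro sum.mono_neutral_right) auto
      then show ?thesis using X(3)[OF hQ[OF that]] sqV[OF that] by simp
    qed
  qed
qed

section \<open>Proof of the two statements\<close>

lemma spanning_subgraph_of_arcs:
  assumes "pair_graph G" "F \<subseteq> parcs G" "sym F"
  shows "spanning_subgraph \<lparr>pverts = pverts G, parcs = F\<rparr> G"
proof -
  let ?F = "\<lparr>pverts = pverts G, parcs = F\<rparr>"
  have F: "pair_graph ?F" using assms by (auto simp: pair_graph_iff irrefl_def)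
  interpret G: pair_graph G by fact
  interpret F: pair_graph ?F by (rule F)
  have "wf_digraph (with_proj G)" "wf_digraph (with_proj ?F)" by unfold_locales
  then have "subgraph (with_proj ?F) (with_proj G)"
    using assms(2) by (auto simp: subgraph_def compatible_def)
  then show ?thesis using F by (simp add: spanning_subgraph_def spanning_def)
qed

text \<open>The handshake identity; it excludes a \<open>k\<close>-factor when \<open>k\<close> and
  the order are both odd, which is half of being critical.\<close>

lemma has_factor_imp_even:
  assumes "has_factor k G"
  shows "even (k * int (gorder G))"
proof -
  obtain F where F: "spanning_subgraph F G" "\<And>x. x \<in> pverts G \<Longrightarrow> int (vdegree F x) = k"
    using assms by (auto simp: has_factor_def is_factor_def)
  have pF: "pair_graph F" and V: "pverts F = pverts G"
    using F(1) by (auto simp: spanning_subgraph_def spanning_def)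
  have fin: "finite (pverts F)" "finite (parcs F)" and sub: "parcs F \<subseteq> pverts F \<times> pverts F"
    using pF by (auto simp: pair_graph_iff intro: finite_subset)
  have "card (parcs F) = card (parcs F \<inter> pverts F \<times> pverts F)"
    using sub by (simp add: Int_absorb2)
  also have "\<dots> = (\<Sum>v\<in>pverts F. card (parcs F `` {v} \<inter> pverts F))"
    by (rule card_arcs_from[OF fin(2,1)])
  also have "\<dots> = (\<Sum>v\<in>pverts F. vdegree F v)"
  proof (rule sum.cong[OF refl])
    fix v
    have "parcs F `` {v} \<inter> pverts F = parcs F `` {v}" using sub by auto
    then show "card (parcs F `` {v} \<inter> pverts F) = vdegree F v" by (simp add: vdegree_conv)
  qed
  finally have "int (2 * gsize F) = (\<Sum>v\<in>pverts F. int (vdegree F v))"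
    using card_parcs[OF pF] by simp
  also have "\<dots> = (\<Sum>v\<in>pverts F. k)" using F(2) V by (intro sum.cong) auto
  finally have eq: "k * int (gorder G) = 2 * int (gsize F)" using V by (simp add: mult.commute)
  show ?thesis unfolding eq by simp
qed

theorem theorem3p2:
  fixes r k m m0 :: int and n :: nat and G :: "'a pair_pre_digraph"
  assumes "even r" and "odd k"
    and "pair_graph G" and "gconnected G" and "regular r G" and "gorder G = n"
    and "m \<ge> 3" and "m0 \<in> {m, m - 1}" and "odd m0"
    and "real_of_int r / real_of_int m \<le> real_of_int k"
    and "real_of_int k \<le> real_of_int r * (1 - 1 / real_of_int m)"
  shows "(odd n \<and> lam 2 G < rho1 r (m0 - 1) \<longrightarrow> critical k G)
       \<and> (even n \<and> lam 3 G < rho1 r (m0 - 1) \<longrightarrow> has_factor k G)"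
proof -
  let ?V = "pverts G" and ?E = "parcs G"
  have fin: "finite ?V" and EV: "?E \<subseteq> ?V \<times> ?V" and sym: "sym ?E" and irr: "irrefl ?E"
    using assms(3) by (auto simp: pair_graph_iff)
  have conn: "?V \<noteq> {}" "\<And>u. u \<in> ?V \<Longrightarrow> ?V \<subseteq> gcomp ?E ?V u"
    using assms(4) gconnected_iff[OF sym] by auto
  have "gcomp ?E ?V u = ?V" if "u \<in> ?V" for u
    using conn(2)[OF that] gcomp_subset[OF that] by (rule subset_antisym[rotated])
  then have comps: "comps ?E ?V = {?V}" using conn(1) by (auto simp: comps_def)
  obtain v0 where v0: "v0 \<in> ?V" using conn(1) by blast
  define r' where "r' = nat r"
  define k' where "k' = nat k"
  have "int (vdegree G v0) = r" using assms(5) v0 by (auto simp: regular_def)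
  then have r0: "r \<ge> 0" by (metis of_nat_0_le_iff)
  have mk: "r \<le> m * k"
  proof -
    have "real_of_int r \<le> real_of_int (m * k)" using assms(7,10) by (simp add: field_simps)
    then show ?thesis by (simp only: of_int_le_iff)
  qed
  have mrk: "r \<le> m * (r - k)"
  proof -
    have "real_of_int r \<le> real_of_int (m * (r - k))" using assms(7,11) by (simp add: field_simps)
    then show ?thesis by (simp only: of_int_le_iff)
  qed
  \<comment> \<open>The one-vertex graph with \<open>r = 0\<close> is not excluded a priori. Oddness
    gives \<open>k \<noteq> 0\<close>, and a negative \<open>k\<close> contradicts
    \<open>0 \<le> r \<le> m * k\<close>.\<close>
  have k0: "k > 0"
  proof (rule ccontr)
    assume "\<not> k > 0"
    then have "m * k \<le> 0" "k \<noteq> 0" using assms(2,7) by (auto simp: mult_le_0_iff)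
    then have "m * k < 0" using assms(7) \<open>\<not> k > 0\<close> by (simp add: mult_less_0_iff)
    then show False using mk r0 by linarith
  qed
  have "r \<noteq> 0" using mrk k0 assms(7) by (auto simp: mult_le_0_iff zero_le_mult_iff)
  then have "m * (r - k) > 0" using mrk r0 by linarith
  then have kr: "k < r" using assms(7) by (simp add: zero_less_mult_iff)
  have rk': "int r' = r" "int k' = k" using r0 k0 by (simp_all add: r'_def k'_def)
  have evr: "even r'" and oddk: "odd k'" using assms(1,2) rk' even_of_nat[where 'a = int] by metis+
  have k': "0 < k'" "k' < r'" using k0 kr rk' by linarith+
  have reg: "card (?E `` {v}) = r'" if "v \<in> ?V" for v
    using assms(5) that rk'(1) by (metis regular_def vdegree_conv of_nat_eq_iff)
  have m: "int r' \<le> m * int k'" "int r' \<le> m * int (r' - k')"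
    using mk mrk rk' k' by (simp_all add: of_nat_diff)
  have nV: "card ?V = n" by (rule assms(6))
  note bound = lam_ge_rho1_of_light_components[OF assms(3) reg k' evr _ _ _ _ _ _ _ _ _ m assms(8,9)]
  have "critical k G" if n: "odd n" and lam: "lam 2 G < rho1 r (m0 - 1)"
    unfolding critical_def
  proof (intro conjI ballI)
    show "\<not> has_factor k G"
      using has_factor_imp_even[of k G] assms(2) n nV by auto
    fix x assume x: "x \<in> ?V"
    have "\<exists>F\<subseteq>?E. sym F \<and> (\<forall>v\<in>?V. if v \<in> {x} then card (F `` {v}) = k' + 1 \<or> card (F `` {v}) + 1 = k'
       else card (F `` {v}) = k')"
    proof (rule ccontr)
      assume neg: "\<not> ?thesis"
      \<comment> \<open>Raising the target at \<open>x\<close> to \<open>k' + 1\<close> repairs the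
        parity of the odd number \<open>k' * n\<close>.\<close>
      have "(\<Sum>v\<in>?V. if v \<in> {x} then k' + 1 else k') = (\<Sum>v\<in>?V. k' + (if v = x then 1 else 0))"
        by (intro sum.cong) auto
      also have "\<dots> = k' * n + 1" using fin x nV by (simp add: sum.distrib mult.commute)
      finally have ev: "even (\<Sum>v\<in>?V. if v \<in> {x} then k' + 1 else k')" using oddk n by simp
      obtain S T \<Q> where ST: "S \<subseteq> ?V" "T \<subseteq> ?V" "S \<inter> T = {}"
        and Q: "\<Q> \<subseteq> comps ?E (?V - S - T)" "3 \<le> card \<Q>"
        and light: "\<And>K. K \<in> \<Q> \<Longrightarrow> k' * card (?E \<inter> S \<times> K) + (r' - k') * card (?E \<inter> T \<times> K) < r'"
        and pos: "\<And>K. K \<in> \<Q> \<Longrightarrow> 0 < k' * card (?E \<inter> S \<times> K) + (r' - k') * card (?E \<inter> T \<times> K)"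
        and par: "\<And>K. K \<in> \<Q> \<Longrightarrow> K \<inter> {x} = {} \<Longrightarrow> odd (k' * card K + r' * card K + card (?E \<inter> S \<times> K))"
        using light_components[OF fin EV sym irr reg comps k' ev neg] by metis
      \<comment> \<open>Components are disjoint, so at most one of the three or more contains
        \<open>x\<close>; at least two survive its removal.\<close>
      define \<Q>' where "\<Q>' = {K \<in> \<Q>. x \<notin> K}"
      have "\<exists>K0. \<Q> - {K0} \<subseteq> \<Q>'"
      proof (cases "\<exists>K\<in>\<Q>. x \<in> K")
        case True
        then obtain K0 where K0: "K0 \<in> \<Q>" "x \<in> K0" by blast
        have "K = K0" if "K \<in> \<Q>" "x \<in> K" for K
          using comps_eq[OF sym, of K "?V - S - T" K0 x] that K0 Q(1) by blast
        then show ?thesis by (intro exI[of _ K0]) (auto simp: \<Q>'_def)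
      qed (auto simp: \<Q>'_def)
      then obtain K0 where K0: "\<Q> - {K0} \<subseteq> \<Q>'" by blast
      have finQ: "finite \<Q>" using Q(2) card_ge_0_finite by force
      have "card \<Q> - 1 \<le> card (\<Q> - {K0})" by (simp add: card_Diff_singleton_if)
      also have "\<dots> \<le> card \<Q>'" using K0 finQ by (intro card_mono) (auto simp: \<Q>'_def)
      finally have c: "2 \<le> card \<Q>'" using Q(2) by simp
      have Q': "\<Q>' \<subseteq> comps ?E (?V - S - T)" using Q(1) by (auto simp: \<Q>'_def)
      have "rho1 (int r') (m0 - 1) \<le> lam 2 G"
        by (rule bound[OF _ ST Q']) (use light pos par c in \<open>auto simp: \<Q>'_def\<close>)
      then show False using lam rk' by simp
    qed
    then obtain F where F: "F \<subseteq> ?E" "sym F"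
      "\<And>v. v \<in> ?V \<Longrightarrow> if v \<in> {x} then card (F `` {v}) = k' + 1 \<or> card (F `` {v}) + 1 = k'
         else card (F `` {v}) = k'" by blast
    let ?H = "\<lparr>pverts = ?V, parcs = F\<rparr>"
    have "int (vdegree ?H x) = k - 1 \<or> int (vdegree ?H x) = k + 1"
      using F(3)[OF x] rk'(2) by (auto simp: vdegree_conv)
    moreover have "int (vdegree ?H y) = k" if "y \<in> ?V" "y \<noteq> x" for y
      using F(3)[OF that(1)] that(2) rk'(2) by (auto simp: vdegree_conv)
    ultimately show "\<exists>H. spanning_subgraph H G \<and> (int (vdegree H x) = k - 1 \<or> int (vdegree H x) = k + 1)
        \<and> (\<forall>y \<in> ?V. y \<noteq> x \<longrightarrow> int (vdegree H y) = k)"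
      using spanning_subgraph_of_arcs[OF assms(3) F(1,2)] by blast
  qed
  moreover have "has_factor k G" if n: "even n" and lam: "lam 3 G < rho1 r (m0 - 1)"
  proof -
    have "\<exists>F\<subseteq>?E. sym F \<and> (\<forall>v\<in>?V. if v \<in> {} then card (F `` {v}) = k' + 1 \<or> card (F `` {v}) + 1 = k'
       else card (F `` {v}) = k')"
    proof (rule ccontr)
      assume neg: "\<not> ?thesis"
      have ev: "even (\<Sum>v\<in>?V. if v \<in> {} then k' + 1 else k')" using n nV by simp
      obtain S T \<Q> where ST: "S \<subseteq> ?V" "T \<subseteq> ?V" "S \<inter> T = {}"
        and Q: "\<Q> \<subseteq> comps ?E (?V - S - T)" "3 \<le> card \<Q>"
        and light: "\<And>K. K \<in> \<Q> \<Longrightarrow> k' * card (?E \<inter> S \<times> K) + (r' - k') * card (?E \<inter> T \<times> K) < r'"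
        and pos: "\<And>K. K \<in> \<Q> \<Longrightarrow> 0 < k' * card (?E \<inter> S \<times> K) + (r' - k') * card (?E \<inter> T \<times> K)"
        and par: "\<And>K. K \<in> \<Q> \<Longrightarrow> K \<inter> {} = {} \<Longrightarrow> odd (k' * card K + r' * card K + card (?E \<inter> S \<times> K))"
        using light_components[OF fin EV sym irr reg comps k' ev neg] by metis
      have "rho1 (int r') (m0 - 1) \<le> lam 3 G"
        by (rule bound[OF _ ST Q(1)]) (use Q light pos par in auto)
      then show False using lam rk' by simp
    qed
    then obtain F where F: "F \<subseteq> ?E" "sym F" "\<And>v. v \<in> ?V \<Longrightarrow> card (F `` {v}) = k'" by auto
    have "is_factor k \<lparr>pverts = ?V, parcs = F\<rparr> G"
      using spanning_subgraph_of_arcs[OF assms(3) F(1,2)] F(3) rk'(2)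
      by (auto simp: is_factor_def vdegree_conv)
    then show ?thesis by (auto simp: has_factor_def)
  qed
  ultimately show ?thesis by blast
qed

end
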